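(* Let $T=\begin{pmatrix}A&B\\C&-A^*\end{pmatrix}$ be a diagonally dominant, nonnegative Hamiltonian operator matrix on $H\times H$ with $\varrho(T)\cap i\mathbb R\neq\varnothing$ and a finitely spectral Riesz basis of subspaces $(V_k)_{k\in\mathbb N}$. Suppose that (a) $B$ is positive, or (b) there is a connected component $M$ of $\varrho(A)$ such that $M\cap\varrho(T)\cap i\mathbb R\neq\varnothing$ and $$\operatorname{span}\bigl\{(A-z)^{-1}B^*u\,\big|\,z\in M,\ u\in\mathcal D(B^* )\bigr\}\subset H\quad\text{is dense}.$$ Then every subspace $U\subset H\times H$ that is hypermaximal $J_1$-neutral, $T$-invariant and compatible with $(V_k)_{k\in\mathbb N}$ is the graph $U=\Gamma(X)$ of a selfadjoint operator $X$ on $H$ satisfying the Riccati equation $$X(Au+BXu)=Cu-A^*Xu,\qquad u\in\mathcal D(A)\cap X^{-1}\mathcal D(A^* ),$$ and $\mathcal D(A)\cap X^{-1}\mathcal D(A^* )$ is a core for $X$.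
   Context: $H$ is a complex separable Hilbert space with scalar product $(\cdot|\cdot)$, linear in the first argument. $\varrho$ denotes the resolvent set. Hamiltonian operator matrix: a block operator matrix $T=\begin{pmatrix}A&B\\C&-A^*\end{pmatrix}$ on $H\times H$ with domain $\mathcal D(T)=(\mathcal D(A)\cap\mathcal D(C))\times(\mathcal D(A^* )\cap\mathcal D(B))$, where $A,B,C$ are densely defined linear operators on $H$, $B$ and $C$ are symmetric, and $T$ is densely defined. $T$ is nonnegative if $B,C$ are nonnegative. $B$ is positive if $(Bv|v)>0$ for all $v\in\mathcal D(B)\setminus\{0\}$. $T$ is diagonally dominant if $C$ is relatively bounded to $A$ and $B$ is relatively bounded to $A^*$, i.e. $\mathcal D(A)\subset\mathcal D(C)$, $\mathcal D(A^* )\subset\mathcal D(B)$, and there are constants $a,b\ge 0$ with $\|Cu\|\le a\|u\|+b\|Au\|$ for $u\in\mathcal D(A)$ and $\|Bv\|\le a\|v\|+b\|A^*v\|$ for $v\in\mathcal D(A^* )$. $J_1=\begin{pmatrix}0&-iI\\ iI&0\end{pmatrix}$, $\langle x|y\rangle=(J_1x|y)$ on $H\times H$; $U$ is hypermaximal $J_1$-neutral if $U=U^{\langle\perp\rangle}:=\{x:\langle x|y\rangle=0\ \forall y\in U\}$. Riesz basis of subspaces of a separable Hilbert space $V$: a sequence $(V_k)_{k\in\mathbb N}$ of closed subspaces (possibly some equal to $\{0\}$) such that for some isomorphism $\Phi:V\to V$ the subspaces $\Phi(V_k)$ are pairwise orthogonal with dense linear span. For closed subspaces $U_k\subset V_k$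 write $\bigoplus^2_kU_k=\overline{\sum_kU_k}$; a subspace $U$ is compatible with $(V_k)$ if $U=\bigoplus^2_kU_k$ for some closed $U_k\subset V_k$. The Riesz basis $(V_k)$ (here $V=H\times H$) is finitely spectral for a closed operator $T$ if each $V_k$ is finite-dimensional, $V_k\subset\mathcal D(T)$, $V_k$ is $T$-invariant, the sets $\sigma(T|_{V_k})$ are pairwise disjoint, and $\sum_kV_k$ is a core for $T$. (A subspace $D\subset\mathcal D(T)$ is a core for a closed operator $T$ if for every $x\in\mathcal D(T)$ there are $x_n\in D$ with $x_n\to x$, $Tx_n\to Tx$.) Having a finitely spectral Riesz basis of subspaces includes that $T$ is closed. A subspace $U$ is $T$-invariant if $T(U\cap\mathcal D(T))\subset U$. $\Gamma(X)=\{(u,Xu):u\in\mathcal D(X)\}$, and $X^{-1}\mathcal D(A^* )=\{u\in\mathcal D(X):Xu\in\mathcal D(A^* )\}$. The Riccati equation includes the assertion that $Au+BXu\in\mathcal D(X)$ for all the indicated $u$. *)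

theory Defs
  imports "HOL-Analysis.Analysis" "HOL-Library.Disjoint_Sets"
begin

section \<open>Complex Hilbert spaces\<close>

text \<open>
  The scalar product is linear in the first argument. The real structure (norm, metric, topology)
  is that of \<^class>\<open>real_normed_vector\<close>; the axioms tie it to the complex one.
\<close>

class complex_inner = real_normed_vector +
  fixes scaleC :: "complex \<Rightarrow> 'a \<Rightarrow> 'a" (infixr "*\<^sub>C" 75)
    and cinner :: "'a \<Rightarrow> 'a \<Rightarrow> complex"
  assumes scaleC_add_right: "a *\<^sub>C (x + y) = a *\<^sub>C x + a *\<^sub>C y"
    and scaleC_add_left: "(a + b) *\<^sub>C x = a *\<^sub>C x + b *\<^sub>C x"
    and scaleC_scaleC: "a *\<^sub>C (b *\<^sub>C x) = (a * b) *\<^sub>C x"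
    and scaleC_of_real: "complex_of_real r *\<^sub>C x = r *\<^sub>R x"
    and cinner_commute: "cinner y x = cnj (cinner x y)"
    and cinner_add_left: "cinner (x + y) z = cinner x z + cinner y z"
    and cinner_scaleC_left: "cinner (a *\<^sub>C x) y = a * cinner x y"
    and cinner_self: "cinner x x = complex_of_real ((norm x)\<^sup>2)"

class chilbert_space = complex_inner + complete_space

global_interpretation complex_vector: vector_space "scaleC :: complex \<Rightarrow> 'a \<Rightarrow> 'a::complex_inner"
  defines csubspace = complex_vector.subspace
    and cspan = complex_vector.span
proof unfold_locales
  show "1 *\<^sub>C x = x" for x :: 'a
    using scaleC_of_real[of 1 x] by simp
qed (simp_all add: scaleC_add_right scaleC_add_left scaleC_scaleC)

instantiation complex :: chilbert_space
begin

definition scaleC_complex :: "complex \<Rightarrow> complex \<Rightarrow> complex"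
  where "scaleC_complex a x = a * x"

definition cinner_complex :: "complex \<Rightarrow> complex \<Rightarrow> complex"
  where "cinner_complex x y = x * cnj y"

instance
proof
  show "cinner x x = complex_of_real ((norm x)\<^sup>2)" for x :: complex
    unfolding cinner_complex_def by (rule complex_norm_square[symmetric])
qed (auto simp: scaleC_complex_def cinner_complex_def algebra_simps scaleR_conv_of_real)

end

instantiation prod :: (complex_inner, complex_inner) complex_inner
begin

definition scaleC_prod :: "complex \<Rightarrow> 'a \<times> 'b \<Rightarrow> 'a \<times> 'b"
  where "scaleC_prod a x = (a *\<^sub>C fst x, a *\<^sub>C snd x)"

definition cinner_prod :: "'a \<times> 'b \<Rightarrow> 'a \<times> 'b \<Rightarrow> complex"
  where "cinner_prod x y = cinner (fst x) (fst y) + cinner (snd x) (snd y)"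

instance
proof
  show "cinner x x = complex_of_real ((norm x)\<^sup>2)" for x :: "'a \<times> 'b"
    by (simp add: cinner_prod_def norm_prod_def cinner_self)
  show "cinner y x = cnj (cinner x y)" for x y :: "'a \<times> 'b"
    using cinner_commute[of "fst y" "fst x"] cinner_commute[of "snd y" "snd x"]
    by (simp add: cinner_prod_def)
  show "a *\<^sub>C (x + y) = a *\<^sub>C x + a *\<^sub>C y" for a and x y :: "'a \<times> 'b"
    by (simp add: scaleC_prod_def scaleC_add_right)
  show "(a + b) *\<^sub>C x = a *\<^sub>C x + b *\<^sub>C x" for a b and x :: "'a \<times> 'b"
    by (simp add: scaleC_prod_def scaleC_add_left)
  show "a *\<^sub>C (b *\<^sub>C x) = (a * b) *\<^sub>C x" for a b and x :: "'a \<times> 'b"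
    by (simp add: scaleC_prod_def scaleC_scaleC)
  show "complex_of_real r *\<^sub>C x = r *\<^sub>R x" for r and x :: "'a \<times> 'b"
    by (simp add: scaleC_prod_def scaleC_of_real scaleR_prod_def)
  show "cinner (x + y) z = cinner x z + cinner y z" for x y z :: "'a \<times> 'b"
    by (simp add: cinner_prod_def cinner_add_left)
  show "cinner (a *\<^sub>C x) y = a * cinner x y" for a and x y :: "'a \<times> 'b"
    by (simp add: cinner_prod_def scaleC_prod_def cinner_scaleC_left distrib_left)
qed

end

instance prod :: (chilbert_space, chilbert_space) chilbert_space ..

lemma cinner_add_right: "cinner x (y + z) = cinner x y + cinner x z"
  unfolding cinner_commute[of x "y + z"] cinner_commute[of x y] cinner_commute[of x z]
  by (simp add: cinner_add_left)

lemma cinner_scaleC_right: "cinner x (a *\<^sub>C y) = cnj a * cinner x y"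
  unfolding cinner_commute[of x "a *\<^sub>C y"] cinner_commute[of x y]
  by (simp add: cinner_scaleC_left)

lemma cinner_diff_left: "cinner (x - y) z = cinner x z - cinner y z"
  by (metis add_diff_cancel_right' cinner_add_left diff_add_cancel)

lemma cinner_diff_right: "cinner x (y - z) = cinner x y - cinner x z"
  by (metis add_diff_cancel_right' cinner_add_right diff_add_cancel)

definition cfinite_dim :: "'a::complex_inner set \<Rightarrow> bool"
  where "cfinite_dim V \<longleftrightarrow> (\<exists>S. finite S \<and> cspan S = V)"


section \<open>Unbounded linear operators\<close>

text \<open>
  A (not necessarily everywhere defined) operator is a partial function, with domain
  \<^const>\<open>dom\<close> and graph \<^const>\<open>Map.graph\<close>. The value \<open>A \<cdot> u\<close> is meaningful for \<open>u \<in> dom A\<close> only.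
\<close>

abbreviation opapp :: "('a \<rightharpoonup> 'b) \<Rightarrow> 'a \<Rightarrow> 'b" (infixr "\<cdot>" 90)
  where "A \<cdot> u \<equiv> the (A u)"

definition linear_op :: "('a::complex_inner \<rightharpoonup> 'b::complex_inner) \<Rightarrow> bool"
  where "linear_op A \<longleftrightarrow> csubspace (dom A)
    \<and> (\<forall>u\<in>dom A. \<forall>v\<in>dom A. A \<cdot> (u + v) = A \<cdot> u + A \<cdot> v)
    \<and> (\<forall>a. \<forall>u\<in>dom A. A \<cdot> (a *\<^sub>C u) = a *\<^sub>C (A \<cdot> u))"

definition densely_defined :: "('a::complex_inner \<rightharpoonup> 'b::complex_inner) \<Rightarrow> bool"
  where "densely_defined A \<longleftrightarrow> closure (dom A) = UNIV"

definition closed_op :: "('a::complex_inner \<rightharpoonup> 'b::complex_inner) \<Rightarrow> bool"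
  where "closed_op A \<longleftrightarrow> linear_op A \<and> closed (Map.graph A)"

text \<open>The adjoint is the usual one only for densely defined \<open>A\<close>, where the value is unique.\<close>

definition adjoint_op :: "('a::complex_inner \<rightharpoonup> 'b::complex_inner) \<Rightarrow> 'b \<rightharpoonup> 'a"
  where "adjoint_op A v =
    (if \<exists>w. \<forall>u\<in>dom A. cinner (A \<cdot> u) v = cinner u w
     then Some (THE w. \<forall>u\<in>dom A. cinner (A \<cdot> u) v = cinner u w)
     else None)"

definition symmetric_op :: "('a::complex_inner \<rightharpoonup> 'a) \<Rightarrow> bool"
  where "symmetric_op A \<longleftrightarrow> linear_op A \<and> densely_defined A
    \<and> (\<forall>u\<in>dom A. \<forall>v\<in>dom A. cinner (A \<cdot> u) v = cinner u (A \<cdot> v))"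

definition selfadjoint_op :: "('a::complex_inner \<rightharpoonup> 'a) \<Rightarrow> bool"
  where "selfadjoint_op A \<longleftrightarrow> linear_op A \<and> densely_defined A \<and> adjoint_op A = A"

definition nonneg_op :: "('a::complex_inner \<rightharpoonup> 'a) \<Rightarrow> bool"
  where "nonneg_op A \<longleftrightarrow> (\<forall>v\<in>dom A. cinner (A \<cdot> v) v \<in> \<real> \<and> 0 \<le> Re (cinner (A \<cdot> v) v))"

definition positive_op :: "('a::complex_inner \<rightharpoonup> 'a) \<Rightarrow> bool"
  where "positive_op A \<longleftrightarrow>
    (\<forall>v\<in>dom A - {0}. cinner (A \<cdot> v) v \<in> \<real> \<and> 0 < Re (cinner (A \<cdot> v) v))"

definition rel_bounded :: "('a::complex_inner \<rightharpoonup> 'b::complex_inner) \<Rightarrow> ('a \<rightharpoonup> 'c::complex_inner) \<Rightarrow> bool"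
  where "rel_bounded S A \<longleftrightarrow> dom A \<subseteq> dom S
    \<and> (\<exists>a\<ge>0. \<exists>b\<ge>0. \<forall>u\<in>dom A. norm (S \<cdot> u) \<le> a * norm u + b * norm (A \<cdot> u))"

definition core_of :: "'a::complex_inner set \<Rightarrow> ('a \<rightharpoonup> 'b::complex_inner) \<Rightarrow> bool"
  where "core_of D A \<longleftrightarrow> csubspace D \<and> D \<subseteq> dom A
    \<and> (\<forall>x\<in>dom A. \<exists>s. (\<forall>n::nat. s n \<in> D) \<and> s \<longlonglongrightarrow> x \<and> (\<lambda>n. A \<cdot> s n) \<longlonglongrightarrow> A \<cdot> x)"

definition invariant_under :: "('a \<rightharpoonup> 'a) \<Rightarrow> 'a set \<Rightarrow> bool"
  where "invariant_under T U \<longleftrightarrow> (\<forall>x\<in>U \<inter> dom T. T \<cdot> x \<in> U)"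

text \<open>
  Resolvent set and spectrum of an operator \<open>T\<close> acting in the subspace \<open>V\<close> of the ambient space:
  \<open>T - z\<close> maps \<open>dom T\<close> bijectively onto \<open>V\<close> and the inverse is bounded.
  The ambient space is \<open>V = UNIV\<close>; a restriction to an invariant subspace \<open>V\<close> uses \<open>V\<close>.
\<close>

definition resolvent_set_on :: "'a::complex_inner set \<Rightarrow> ('a \<rightharpoonup> 'a) \<Rightarrow> complex set"
  where "resolvent_set_on V T = {z. bij_betw (\<lambda>x. T \<cdot> x - z *\<^sub>C x) (dom T) V
    \<and> (\<exists>c. \<forall>x\<in>dom T. norm x \<le> c * norm (T \<cdot> x - z *\<^sub>C x))}"

definition spectrum_on :: "'a::complex_inner set \<Rightarrow> ('a \<rightharpoonup> 'a) \<Rightarrow> complex set"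
  where "spectrum_on V T = - resolvent_set_on V T"

abbreviation resolvent_set :: "('a::complex_inner \<rightharpoonup> 'a) \<Rightarrow> complex set"
  where "resolvent_set T \<equiv> resolvent_set_on UNIV T"

definition resolvent :: "('a::complex_inner \<rightharpoonup> 'a) \<Rightarrow> complex \<Rightarrow> 'a \<Rightarrow> 'a"
  where "resolvent A z = inv_into (dom A) (\<lambda>x. A \<cdot> x - z *\<^sub>C x)"

definition imaginary_axis :: "complex set"
  where "imaginary_axis = range (\<lambda>t. \<i> * complex_of_real t)"


section \<open>Riesz bases of subspaces\<close>

definition isomorphism :: "('a::complex_inner \<Rightarrow> 'b::complex_inner) \<Rightarrow> bool"
  where "isomorphism \<Phi> \<longleftrightarrow> bij \<Phi> \<and> (\<forall>a x. \<Phi> (a *\<^sub>C x) = a *\<^sub>C \<Phi> x)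
    \<and> bounded_linear \<Phi> \<and> bounded_linear (inv \<Phi>)"

definition riesz_basis_subspaces :: "(nat \<Rightarrow> 'a::chilbert_space set) \<Rightarrow> bool"
  where "riesz_basis_subspaces V \<longleftrightarrow> (\<forall>k. csubspace (V k) \<and> closed (V k))
    \<and> (\<exists>\<Phi> :: 'a \<Rightarrow> 'a. isomorphism \<Phi>
        \<and> (\<forall>j k. j \<noteq> k \<longrightarrow> (\<forall>x\<in>\<Phi> ` V j. \<forall>y\<in>\<Phi> ` V k. cinner x y = 0))
        \<and> closure (cspan (\<Union>k. \<Phi> ` V k)) = UNIV)"

text \<open>The algebraic sum \<open>\<Sum>\<^sub>k V k\<close> is rendered as the span of the union.\<close>

definition compatible_with :: "(nat \<Rightarrow> 'a::chilbert_space set) \<Rightarrow> 'a set \<Rightarrow> bool"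
  where "compatible_with V U \<longleftrightarrow>
    (\<exists>W. (\<forall>k. csubspace (W k) \<and> closed (W k) \<and> W k \<subseteq> V k) \<and> U = closure (cspan (\<Union>k. W k)))"

definition finitely_spectral_basis :: "('a::chilbert_space \<rightharpoonup> 'a) \<Rightarrow> (nat \<Rightarrow> 'a set) \<Rightarrow> bool"
  where "finitely_spectral_basis T V \<longleftrightarrow> closed_op T \<and> riesz_basis_subspaces V
    \<and> (\<forall>k. cfinite_dim (V k) \<and> V k \<subseteq> dom T \<and> invariant_under T (V k))
    \<and> disjoint_family (\<lambda>k. spectrum_on (V k) (T |` V k))
    \<and> core_of (cspan (\<Union>k. V k)) T"


section \<open>Hamiltonian operator matrices\<close>

definition hamiltonian_matrix ::
    "('h::complex_inner \<rightharpoonup> 'h) \<Rightarrow> ('h \<rightharpoonup> 'h) \<Rightarrow> ('h \<rightharpoonup> 'h) \<Rightarrow> 'h \<times> 'h \<rightharpoonup> 'h \<times> 'h"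
  where "hamiltonian_matrix A B C = (\<lambda>(u, v).
    if u \<in> dom A \<inter> dom C \<and> v \<in> dom (adjoint_op A) \<inter> dom B
    then Some (A \<cdot> u + B \<cdot> v, C \<cdot> u - adjoint_op A \<cdot> v) else None)"

definition hamiltonian :: "('h::complex_inner \<rightharpoonup> 'h) \<Rightarrow> ('h \<rightharpoonup> 'h) \<Rightarrow> ('h \<rightharpoonup> 'h) \<Rightarrow> bool"
  where "hamiltonian A B C \<longleftrightarrow> linear_op A \<and> densely_defined A \<and> symmetric_op B \<and> symmetric_op C
    \<and> densely_defined (hamiltonian_matrix A B C)"

definition diagonally_dominant :: "('h::complex_inner \<rightharpoonup> 'h) \<Rightarrow> ('h \<rightharpoonup> 'h) \<Rightarrow> ('h \<rightharpoonup> 'h) \<Rightarrow> bool"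
  where "diagonally_dominant A B C \<longleftrightarrow> rel_bounded C A \<and> rel_bounded B (adjoint_op A)"

definition J1 :: "'h::complex_inner \<times> 'h \<Rightarrow> 'h \<times> 'h"
  where "J1 x = (- (\<i> *\<^sub>C snd x), \<i> *\<^sub>C fst x)"

definition hypermaximal_J1_neutral :: "('h::complex_inner \<times> 'h) set \<Rightarrow> bool"
  where "hypermaximal_J1_neutral U \<longleftrightarrow> U = {x. \<forall>y\<in>U. cinner (J1 x) y = 0}"

text \<open>\<open>D(A) \<inter> X\<^sup>-\<^sup>1D(A\<^sup>*)\<close>, the set on which the Riccati equation is posed.\<close>

definition riccati_domain :: "('h::complex_inner \<rightharpoonup> 'h) \<Rightarrow> ('h \<rightharpoonup> 'h) \<Rightarrow> 'h set"
  where "riccati_domain A X = dom A \<inter> {u \<in> dom X. X \<cdot> u \<in> dom (adjoint_op A)}"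


section \<open>Consistency of the encodings\<close>

lemma dense_orthogonal_zero:
  fixes w :: "'a::complex_inner"
  assumes "closure D = UNIV" and orth: "\<And>u. u \<in> D \<Longrightarrow> cinner u w = 0"
  shows "w = 0"
proof (rule ccontr)
  assume "w \<noteq> 0"
  then have "norm w > 0" by simp
  moreover have "w \<in> closure D" using assms(1) by simp
  ultimately obtain u where u: "u \<in> D" "dist u w < norm w"
    by (meson closure_approachable)
  have "cinner u w = 0" "cinner w u = 0"
    using orth[OF u(1)] cinner_commute[of w u] by simp_all
  then have "cinner (w - u) (w - u) = cinner w w + cinner u u"
    unfolding cinner_diff_left cinner_diff_right by simp
  then have "complex_of_real ((norm (w - u))\<^sup>2) = of_real ((norm w)\<^sup>2 + (norm u)\<^sup>2)"
    unfolding cinner_self of_real_add .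
  then have "(norm (w - u))\<^sup>2 = (norm w)\<^sup>2 + (norm u)\<^sup>2"
    unfolding of_real_eq_iff .
  then have "(norm w)\<^sup>2 \<le> (norm (w - u))\<^sup>2"
    using zero_le_power2[of "norm u"] by linarith
  then have "norm w \<le> norm (w - u)"
    by (rule power2_le_imp_le) (rule norm_ge_zero)
  then show False
    using u(2) by (simp add: dist_norm norm_minus_commute)
qed

lemma adjoint_op_eq_Some_iff:
  assumes "densely_defined A"
  shows "adjoint_op A v = Some w \<longleftrightarrow> (\<forall>u\<in>dom A. cinner (A \<cdot> u) v = cinner u w)"
proof -
  have uniq: "w1 = w2"
    if w1: "\<forall>u\<in>dom A. cinner (A \<cdot> u) v = cinner u w1"
      and w2: "\<forall>u\<in>dom A. cinner (A \<cdot> u) v = cinner u w2" for w1 w2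
  proof -
    have "w1 - w2 = 0"
    proof (rule dense_orthogonal_zero)
      show "closure (dom A) = UNIV" using assms by (simp add: densely_defined_def)
      show "cinner u (w1 - w2) = 0" if "u \<in> dom A" for u
        unfolding cinner_diff_right using bspec[OF w1 that] bspec[OF w2 that] by simp
    qed
    then show ?thesis by simp
  qed
  show ?thesis
  proof (cases "\<exists>w. \<forall>u\<in>dom A. cinner (A \<cdot> u) v = cinner u w")
    case True
    then obtain w0 where w0: "\<forall>u\<in>dom A. cinner (A \<cdot> u) v = cinner u w0" by blast
    have "(THE w. \<forall>u\<in>dom A. cinner (A \<cdot> u) v = cinner u w) = w0"
      by (rule the_equality, rule w0, erule uniq, rule w0)
    then have Some_w0: "adjoint_op A v = Some w0"
      using True by (simp add: adjoint_op_def)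
    show ?thesis
    proof
      assume "adjoint_op A v = Some w"
      then have "w = w0" using Some_w0 by simp
      then show "\<forall>u\<in>dom A. cinner (A \<cdot> u) v = cinner u w" using w0 by blast
    next
      assume "\<forall>u\<in>dom A. cinner (A \<cdot> u) v = cinner u w"
      then have "w = w0" using w0 by (rule uniq)
      then show "adjoint_op A v = Some w" using Some_w0 by simp
    qed
  next
    case False
    then have "adjoint_op A v = None" by (simp only: adjoint_op_def if_False)
    then show ?thesis using False by (metis option.distinct(1))
  qed
qed

end

theory Submission
  imports Defs "HOL-Complex_Analysis.Conformal_Mappings"
begin

text \<open>
  The heart of the matter is that \<open>(0, w) \<in> U\<close> forces \<open>w = 0\<close>. For \<open>z \<in> \<rho>(T) \<inter> i\<real>\<close> the subspace \<open>U\<close> is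
  invariant under \<open>(T - z)\<^sup>-\<^sup>1\<close>, because \<open>T - z\<close> is injective, hence bijective, on the finite-dimensional
  spaces \<open>U \<inter> V\<^sub>k\<close>. With \<open>(u, v) = (T - z)\<^sup>-\<^sup>1 (0, w) \<in> U\<close>, neutrality gives
  \<open>0 = (u|w) = (u|Cu) + (Bv|v)\<close>, so that \<open>Cu = 0\<close> and \<open>Bv = 0\<close> by the Cauchy-Schwarz inequality.
  If \<open>B\<close> is positive, then \<open>v = 0\<close> and \<open>w = Cu = 0\<close>. Otherwise \<open>w = -(A\<^sup>* + z)v\<close>
  yields \<open>((A - z)\<^sup>-\<^sup>1 B\<^sup>* y|w) = -(y|Bv) = 0\<close> for all \<open>z \<in> M \<inter> \<rho>(T) \<inter> i\<real>\<close>; by the identity theorem this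
  holds on all of \<open>M\<close>, and \<open>w = 0\<close> by density. The selfadjointness of \<open>X\<close> then amounts to \<open>U = U\<^sup>\<langle>\<^sup>\<bottom>\<^sup>\<rangle>\<close>, the Riccati equation to
  the invariance of \<open>U\<close>, and the core property to the compatibility of \<open>U\<close> with \<open>(V\<^sub>k)\<close>.
\<close>

section \<open>Complex inner product spaces\<close>

lemma cinner_zero_left [simp]: "cinner 0 x = 0"
  by (metis cinner_diff_left diff_self)

lemma cinner_zero_right [simp]: "cinner x 0 = 0"
  by (metis cinner_diff_right diff_self)

lemma cinner_minus_left: "cinner (- x) y = - cinner x y"
  by (metis cinner_diff_left cinner_zero_left diff_0)

lemma cinner_minus_right: "cinner x (- y) = - cinner x y"
  by (metis cinner_diff_right cinner_zero_right diff_0)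

lemma cinner_eq_zero_commute: "cinner x y = 0 \<longleftrightarrow> cinner y x = 0"
  by (metis cinner_commute complex_cnj_zero)

text \<open>The common source of the parallelogram law, of the first variation of a squared distance
  and, by polarization, of the continuity of \<open>cinner\<close> in its first argument.\<close>

lemma norm_add_squared:
  fixes x y :: "'a::complex_inner"
  shows "(norm (x + y))\<^sup>2 = (norm x)\<^sup>2 + (norm y)\<^sup>2 + 2 * Re (cinner x y)"
proof -
  have "complex_of_real ((norm (x + y))\<^sup>2)
      = complex_of_real ((norm x)\<^sup>2 + (norm y)\<^sup>2) + (cinner x y + cnj (cinner x y))"
    unfolding cinner_self[symmetric] of_real_add
    by (simp add: cinner_add_left cinner_add_right cinner_commute[of y x])
  also have "\<dots> = complex_of_real ((norm x)\<^sup>2 + (norm y)\<^sup>2 + 2 * Re (cinner x y))"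
    by (simp add: complex_add_cnj)
  finally show ?thesis
    unfolding of_real_eq_iff .
qed

lemma parallelogram_law:
  fixes x y :: "'a::complex_inner"
  shows "(norm (x + y))\<^sup>2 + (norm (x - y))\<^sup>2 = 2 * (norm x)\<^sup>2 + 2 * (norm y)\<^sup>2"
  using norm_add_squared[of x y] norm_add_squared[of x "- y"]
  by (simp add: cinner_minus_right)

lemma norm_scaleC: "norm (a *\<^sub>C x) = cmod a * norm (x::'a::complex_inner)"
proof -
  have "complex_of_real ((norm (a *\<^sub>C x))\<^sup>2) = complex_of_real ((cmod a * norm x)\<^sup>2)"
    unfolding cinner_self[symmetric] cinner_scaleC_left cinner_scaleC_right power_mult_distrib of_real_mult
    using complex_norm_square[of a] by (simp add: cinner_self power2_eq_square ac_simps)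
  then have "(norm (a *\<^sub>C x))\<^sup>2 = (cmod a * norm x)\<^sup>2"
    unfolding of_real_eq_iff .
  then show ?thesis
    by (simp add: power2_eq_iff_nonneg)
qed

text \<open>Near \<open>t = 0\<close> the linear term dominates the quadratic one and changes sign
  with \<open>t\<close>. This extracts a vanishing first variation from minimality of a distance or
  from nonnegativity of a form.\<close>

lemma linear_coeff_zero_of_quadratic_nonneg:
  fixes a b :: real
  assumes "\<And>t. 0 \<le> t\<^sup>2 * a + t * b"
  shows "b = 0"
proof (rule ccontr)
  assume b: "b \<noteq> 0"
  \<comment> \<open>The sign makes the linear term negative; the summand \<open>1\<close> lets it
    outweigh the quadratic term and keeps the denominator positive when
    \<open>a = 0\<close>.\<close>
  define t where "t = - b / (\<bar>a\<bar> + 1)"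
  have "t\<^sup>2 * a + t * b \<le> t\<^sup>2 * \<bar>a\<bar> + t * b"
    by (intro add_right_mono mult_left_mono) auto
  also have "\<dots> = (b\<^sup>2 / (\<bar>a\<bar> + 1)\<^sup>2) * \<bar>a\<bar> - b\<^sup>2 / (\<bar>a\<bar> + 1)"
    unfolding t_def by (simp add: power2_eq_square)
  also have "\<dots> = - b\<^sup>2 / (\<bar>a\<bar> + 1)\<^sup>2"
    by (simp add: divide_simps power2_eq_square) (simp add: algebra_simps)
  also have "\<dots> < 0"
    using b by (simp add: divide_neg_pos)
  finally show False
    using assms[of t] by simp
qed

text \<open>Variations with a real parameter only control the real part of a scalar product. Testing
  with both \<open>v\<close> and \<open>\<i> *\<^sub>C v\<close> recovers the complex
  number.\<close>

lemma zero_of_Re_unit_multiples: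
  assumes "Re c = 0" "Re (\<i> * c) = 0"
  shows "c = 0"
  using assms by (simp add: complex_eq_iff)

section \<open>Nearest points, orthogonality and density\<close>

text \<open>The squared distance from \<open>r\<close> to the points of \<open>D\<close> is smallest
  at \<open>0\<close>, so its derivative at \<open>0\<close> in every direction \<open>v\<close> of
  \<open>D\<close> vanishes; that derivative is a multiple of
  \<open>Re (cinner v r)\<close>.\<close>

lemma orthogonal_to_nearest_difference:
  fixes r :: "'a::complex_inner"
  assumes D: "csubspace D" and min: "\<And>u. u \<in> D \<Longrightarrow> norm r \<le> norm (r - u)" and u: "u \<in> D"
  shows "cinner u r = 0"
proof -
  have Re0: "Re (cinner v r) = 0" if v: "v \<in> D" for v
  proof -
    have "0 \<le> t\<^sup>2 * (norm v)\<^sup>2 + t * (2 * Re (cinner v r))" for t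
    proof -
      define w where "w = complex_of_real t *\<^sub>C v"
      have "- w \<in> D"
        using v D unfolding w_def
        by (intro complex_vector.subspace_neg complex_vector.subspace_scale)
      then have "(norm r)\<^sup>2 \<le> (norm (w + r))\<^sup>2"
        using min[of "- w"] by (simp add: power_mono add.commute)
      then show ?thesis
        unfolding norm_add_squared
        by (simp add: w_def cinner_scaleC_left norm_scaleC power_mult_distrib)
    qed
    then have "2 * Re (cinner v r) = 0"
      by (rule linear_coeff_zero_of_quadratic_nonneg)
    then show ?thesis by simp
  qed
  have "\<i> *\<^sub>C u \<in> D"
    using u D by (intro complex_vector.subspace_scale)
  then show ?thesis
    using Re0[OF u] Re0[of "\<i> *\<^sub>C u"]
    by (intro zero_of_Re_unit_multiples) (simp_all add: cinner_scaleC_left)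
qed

text \<open>A minimizing sequence in \<open>D\<close> is Cauchy by the parallelogram law, and
  completeness provides its limit. As \<open>D\<close> need not be closed, the minimizer is only
  found in the closure.\<close>

lemma nearest_point_exists:
  fixes x :: "'a::chilbert_space"
  assumes D: "csubspace D"
  obtains y where "y \<in> closure D" "\<And>u. u \<in> D \<Longrightarrow> norm (x - y) \<le> norm (x - u)"
proof -
  have D0: "D \<noteq> {}"
    using D complex_vector.subspace_0 by blast
  define d where "d = infdist x D"
  have d0: "0 \<le> d"
    by (simp add: d_def infdist_nonneg)
  have d_le: "d \<le> norm (x - u)" if "u \<in> D" for u
    using infdist_le[OF that, of x] by (simp add: d_def dist_norm)
  have "\<exists>u\<in>D. norm (x - u) < d + 1 / Suc n" for n
  proof (rule ccontr)
    assume "\<not> ?thesis"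
    then have "d + 1 / Suc n \<le> infdist x D"
      using D0 by (auto simp: infdist_def dist_norm not_less intro!: cINF_greatest)
    then show False by (simp add: d_def field_simps)
  qed
  then obtain s where s: "\<And>n. s n \<in> D" "\<And>n. norm (x - s n) < d + 1 / Suc n"
    by metis
  have gap: "(norm (s m - s n))\<^sup>2 \<le> (8 * d + 4) / Suc N" if "N \<le> m" "N \<le> n" for m n N
  proof -
    have near: "(norm (x - s k))\<^sup>2 \<le> d\<^sup>2 + (2 * d + 1) / Suc N" if "N \<le> k" for k
    proof -
      have "norm (x - s k) \<le> d + 1 / Suc N"
        using s(2)[of k] that by (smt (verit) frac_le of_nat_0_less_iff of_nat_le_iff Suc_le_mono zero_less_Suc)
      then have "(norm (x - s k))\<^sup>2 \<le> (d + 1 / Suc N)\<^sup>2"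
        by (simp add: power_mono)
      also have "\<dots> = d\<^sup>2 + (2 * d + 1 / Suc N) / Suc N"
        by (simp add: power2_eq_square distrib_left distrib_right add_divide_distrib)
      also have "\<dots> \<le> d\<^sup>2 + (2 * d + 1) / Suc N"
        by (intro add_left_mono divide_right_mono) (simp_all add: field_simps)
      finally show ?thesis .
    qed
    \<comment> \<open>Midpoints stay in \<open>D\<close>, hence at distance at least
      \<open>d\<close> from \<open>x\<close>. This bounds the sum term of the parallelogram law from
      below and so the difference term from above.\<close>
    have "complex_of_real (1/2) *\<^sub>C (s m + s n) \<in> D"
      using s(1) D by (intro complex_vector.subspace_scale complex_vector.subspace_add)
    then have "d \<le> norm (x - (1/2) *\<^sub>R (s m + s n))"
      using d_le unfolding scaleC_of_real by blast
    then have "2 * d \<le> norm (2 *\<^sub>R (x - (1/2) *\<^sub>R (s m + s n)))"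
      by simp
    also have "2 *\<^sub>R (x - (1/2) *\<^sub>R (s m + s n)) = (x - s m) + (x - s n)"
      by (simp add: scaleR_diff_right scaleR_2)
    finally have "(2 * d)\<^sup>2 \<le> (norm ((x - s m) + (x - s n)))\<^sup>2"
      using d0 by (intro power_mono) auto
    then have "4 * d\<^sup>2 \<le> (norm ((x - s m) + (x - s n)))\<^sup>2"
      by (simp add: power_mult_distrib)
    then have "(norm (s n - s m))\<^sup>2 \<le> 2 * (norm (x - s m))\<^sup>2 + 2 * (norm (x - s n))\<^sup>2 - 4 * d\<^sup>2"
      using parallelogram_law[of "x - s m" "x - s n"] by simp
    also have "\<dots> \<le> 4 * ((2 * d + 1) / Suc N)"
      using near[OF that(1)] near[OF that(2)] by linarith
    also have "\<dots> = (8 * d + 4) / Suc N"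
      by (simp add: field_simps)
    finally show ?thesis by (simp add: norm_minus_commute)
  qed
  have "Cauchy s"
  proof (rule metric_CauchyI)
    fix e :: real assume e: "0 < e"
    obtain N where N: "(8 * d + 4) / e\<^sup>2 < real N"
      using reals_Archimedean2 by blast
    have "dist (s m) (s n) < e" if "N \<le> m" "N \<le> n" for m n
    proof -
      have "(norm (s m - s n))\<^sup>2 \<le> (8 * d + 4) / Suc N"
        by (rule gap[OF that])
      also have "\<dots> < e\<^sup>2"
      proof -
        have "8 * d + 4 < real N * e\<^sup>2"
          using N e by (simp add: field_simps)
        also have "\<dots> \<le> real (Suc N) * e\<^sup>2"
          by (intro mult_right_mono) auto
        finally show ?thesis
          by (simp add: field_simps)
      qed
      finally show ?thesis
        using e by (simp add: dist_norm power_less_imp_less_base)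
    qed
    then show "\<exists>N. \<forall>m\<ge>N. \<forall>n\<ge>N. dist (s m) (s n) < e" by blast
  qed
  then obtain y where y: "s \<longlonglongrightarrow> y"
    using Cauchy_convergent convergent_def by blast
  have "(\<lambda>n. d + 1 / Suc n) \<longlonglongrightarrow> d + 0"
    by (intro tendsto_intros LIMSEQ_Suc[OF lim_1_over_n])
  moreover have "(\<lambda>n. norm (x - s n)) \<longlonglongrightarrow> norm (x - y)"
    by (intro tendsto_intros y)
  ultimately have "norm (x - y) \<le> d"
    using s(2) by (intro LIMSEQ_le[of "\<lambda>n. norm (x - s n)"]) (auto simp: less_imp_le)
  moreover have "y \<in> closure D"
    using y s(1) closure_sequential by blast
  ultimately show thesis
    using that d_le order_trans by blast
qed

text \<open>The residual \<open>x - y\<close> at a nearest point \<open>y\<close> is orthogonal to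
  \<open>D\<close>, hence zero. The density of the domain of the operator with graph
  \<open>U\<close> is obtained this way.\<close>

lemma dense_if_orthogonal_complement_trivial:
  fixes D :: "'a::chilbert_space set"
  assumes D: "csubspace D" and triv: "\<And>w. (\<And>u. u \<in> D \<Longrightarrow> cinner u w = 0) \<Longrightarrow> w = 0"
  shows "closure D = UNIV"
proof -
  have "x \<in> closure D" for x
  proof -
    obtain y where y: "y \<in> closure D" and min: "\<And>u. u \<in> D \<Longrightarrow> norm (x - y) \<le> norm (x - u)"
      using nearest_point_exists[OF D, of x] by blast
    \<comment> \<open>Since \<open>y\<close> lies only in the closure, the translate
      \<open>y + u\<close> need not belong to \<open>D\<close>; minimality is carried over by
      approximating \<open>y\<close> from \<open>D\<close>.\<close>
    have "norm (x - y) \<le> norm (x - y - u)" if u: "u \<in> D" for u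
    proof -
      obtain s where s: "\<And>n. s n \<in> D" "s \<longlonglongrightarrow> y"
        using y closure_sequential by blast
      have "(\<lambda>n. norm (x - (s n + u))) \<longlonglongrightarrow> norm (x - (y + u))"
        by (intro tendsto_intros s)
      moreover have "norm (x - y) \<le> norm (x - (s n + u))" for n
        using D s(1) u by (intro min complex_vector.subspace_add)
      ultimately show ?thesis
        unfolding diff_diff_eq by (intro LIMSEQ_le_const) auto
    qed
    then have "x - y = 0"
      by (intro triv orthogonal_to_nearest_difference[OF D])
    then show ?thesis using y by simp
  qed
  then show ?thesis by blast
qed

lemma cinner_eq_zero_cspan:
  assumes "x \<in> cspan S" "\<And>s. s \<in> S \<Longrightarrow> cinner s w = 0"
  shows "cinner x w = 0"
  using assms(1)
  by (induction rule: complex_vector.span_induct_alt)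
    (simp_all add: assms(2) cinner_add_left cinner_scaleC_left)


section \<open>Linear operators\<close>

lemma linear_opD:
  assumes "linear_op A"
  shows "csubspace (dom A)"
    and "\<And>u v. u \<in> dom A \<Longrightarrow> v \<in> dom A \<Longrightarrow> A \<cdot> (u + v) = A \<cdot> u + A \<cdot> v"
    and "\<And>a u. u \<in> dom A \<Longrightarrow> A \<cdot> (a *\<^sub>C u) = a *\<^sub>C (A \<cdot> u)"
  using assms by (auto simp: linear_op_def)

lemma linear_op_zero:
  assumes "linear_op A"
  shows "A \<cdot> 0 = 0"
  using linear_opD(2)[OF assms, of 0 0] complex_vector.subspace_0[OF linear_opD(1)[OF assms]]
  by simp

lemma linear_op_diff:
  assumes "linear_op A" "u \<in> dom A" "v \<in> dom A"
  shows "A \<cdot> (u - v) = A \<cdot> u - A \<cdot> v"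
  using linear_opD(2)[OF assms(1), of "u - v" v, OF complex_vector.subspace_diff[OF linear_opD(1)]] assms
  by (simp add: eq_diff_eq)

text \<open>The shift \<open>A - z\<close> is never formed as an operator of its own; these are its
  linearity laws on \<open>dom A\<close>.\<close>

lemma
  assumes "linear_op A"
  shows shifted_add: "u \<in> dom A \<Longrightarrow> v \<in> dom A
      \<Longrightarrow> A \<cdot> (u + v) - z *\<^sub>C (u + v) = (A \<cdot> u - z *\<^sub>C u) + (A \<cdot> v - z *\<^sub>C v)"
    and shifted_diff: "u \<in> dom A \<Longrightarrow> v \<in> dom A
      \<Longrightarrow> A \<cdot> (u - v) - z *\<^sub>C (u - v) = (A \<cdot> u - z *\<^sub>C u) - (A \<cdot> v - z *\<^sub>C v)"
    and shifted_scale: "u \<in> dom A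
      \<Longrightarrow> A \<cdot> (a *\<^sub>C u) - z *\<^sub>C (a *\<^sub>C u) = a *\<^sub>C (A \<cdot> u - z *\<^sub>C u)"
  using linear_opD[OF assms] linear_op_diff[OF assms]
  by (simp_all add: complex_vector.scale_right_distrib complex_vector.scale_right_diff_distrib
      complex_vector.scale_left_commute)

lemma adjoint_op_cinner:
  assumes "densely_defined A" "u \<in> dom A" "v \<in> dom (adjoint_op A)"
  shows "cinner (A \<cdot> u) v = cinner u (adjoint_op A \<cdot> v)"
  using assms adjoint_op_eq_Some_iff[OF assms(1), of v "adjoint_op A \<cdot> v"] by auto

lemma adjoint_opI:
  assumes "densely_defined A" "\<And>u. u \<in> dom A \<Longrightarrow> cinner (A \<cdot> u) v = cinner u w"
  shows "v \<in> dom (adjoint_op A)" "adjoint_op A \<cdot> v = w"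
  using adjoint_op_eq_Some_iff[OF assms(1), of v w] assms(2) by auto

lemma linear_op_adjoint:
  assumes A: "densely_defined A"
  shows "linear_op (adjoint_op A)"
proof -
  note adj = adjoint_op_cinner[OF A] and I = adjoint_opI[OF A]
  have zero: "0 \<in> dom (adjoint_op A)"
    by (rule I(1)[of _ 0]) simp
  have add: "u + v \<in> dom (adjoint_op A)" "adjoint_op A \<cdot> (u + v) = adjoint_op A \<cdot> u + adjoint_op A \<cdot> v"
    if "u \<in> dom (adjoint_op A)" "v \<in> dom (adjoint_op A)" for u v
    using that
    by (intro I(1)[of _ "adjoint_op A \<cdot> u + adjoint_op A \<cdot> v"] I(2); simp only: cinner_add_right adj)+
  have scale: "a *\<^sub>C u \<in> dom (adjoint_op A)" "adjoint_op A \<cdot> (a *\<^sub>C u) = a *\<^sub>C (adjoint_op A \<cdot> u)"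
    if "u \<in> dom (adjoint_op A)" for a u
    using that
    by (intro I(1)[of _ "a *\<^sub>C (adjoint_op A \<cdot> u)"] I(2); simp only: cinner_scaleC_right adj)+
  show ?thesis
    unfolding linear_op_def complex_vector.subspace_def using zero add scale by blast
qed

text \<open>Cauchy-Schwarz for the semidefinite form \<open>(A u|v)\<close>, in its degenerate case.\<close>

lemma nonneg_symmetric_op_eq_zero:
  assumes sym: "symmetric_op A" and nn: "nonneg_op A" and u: "u \<in> dom A"
    and zero: "cinner (A \<cdot> u) u = 0"
  shows "A \<cdot> u = 0"
proof -
  have lin: "linear_op A" and dense: "closure (dom A) = UNIV"
    and sym': "\<And>u v. u \<in> dom A \<Longrightarrow> v \<in> dom A \<Longrightarrow> cinner (A \<cdot> u) v = cinner u (A \<cdot> v)"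
    using sym by (auto simp: symmetric_op_def densely_defined_def)
  note sub = linear_opD(1)[OF lin]
  have Re0: "Re (cinner v (A \<cdot> u)) = 0" if v: "v \<in> dom A" for v
  proof -
    \<comment> \<open>Nonnegativity of the form is tested at \<open>u + t v\<close>. The constant
      term drops out by \<open>zero\<close>, which leaves a quadratic in \<open>t\<close> without
      constant term.\<close>
    have "0 \<le> t\<^sup>2 * Re (cinner (A \<cdot> v) v) + t * (2 * Re (cinner v (A \<cdot> u)))" for t
    proof -
      define c where "c = complex_of_real t"
      have cv: "c *\<^sub>C v \<in> dom A"
        using v sub by (intro complex_vector.subspace_scale)
      then have w: "u + c *\<^sub>C v \<in> dom A"
        using u sub by (intro complex_vector.subspace_add)
      have eq: "cinner (A \<cdot> (u + c *\<^sub>C v)) (u + c *\<^sub>C v)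
          = c * c * cinner (A \<cdot> v) v + c * (cinner v (A \<cdot> u) + cnj (cinner v (A \<cdot> u)))"
        using zero linear_opD(2)[OF lin u cv] linear_opD(3)[OF lin v] sym'[OF v u]
          cinner_commute[of "A \<cdot> u" v]
        by (simp add: cinner_add_left cinner_add_right cinner_scaleC_left cinner_scaleC_right
            c_def algebra_simps)
      have "0 \<le> Re (cinner (A \<cdot> (u + c *\<^sub>C v)) (u + c *\<^sub>C v))"
        using nn w by (simp add: nonneg_op_def)
      then show ?thesis
        unfolding eq complex_add_cnj by (simp add: c_def power2_eq_square)
    qed
    then have "2 * Re (cinner v (A \<cdot> u)) = 0"
      by (rule linear_coeff_zero_of_quadratic_nonneg)
    then show ?thesis by simp
  qed
  show ?thesis
  proof (rule dense_orthogonal_zero[OF dense])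
    fix v assume v: "v \<in> dom A"
    have "\<i> *\<^sub>C v \<in> dom A"
      using v sub by (intro complex_vector.subspace_scale)
    then show "cinner v (A \<cdot> u) = 0"
      using Re0[OF v] Re0[of "\<i> *\<^sub>C v"]
      by (intro zero_of_Re_unit_multiples) (simp_all add: cinner_scaleC_left)
  qed
qed


section \<open>Resolvents\<close>

lemma resolvent_setD:
  assumes "z \<in> resolvent_set A"
  shows "inj_on (\<lambda>x. A \<cdot> x - z *\<^sub>C x) (dom A)"
    and "resolvent A z y \<in> dom A"
    and "A \<cdot> resolvent A z y - z *\<^sub>C resolvent A z y = y"
    and "x \<in> dom A \<Longrightarrow> resolvent A z (A \<cdot> x - z *\<^sub>C x) = x"
proof -
  have bij: "bij_betw (\<lambda>x. A \<cdot> x - z *\<^sub>C x) (dom A) UNIV"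
    using assms by (simp add: resolvent_set_on_def)
  then show inj: "inj_on (\<lambda>x. A \<cdot> x - z *\<^sub>C x) (dom A)"
    and "resolvent A z y \<in> dom A"
    and "A \<cdot> resolvent A z y - z *\<^sub>C resolvent A z y = y"
    using inv_into_into[of y "\<lambda>x. A \<cdot> x - z *\<^sub>C x" "dom A"]
      f_inv_into_f[of y "\<lambda>x. A \<cdot> x - z *\<^sub>C x" "dom A"]
    by (auto simp: bij_betw_def resolvent_def)
  show "x \<in> dom A \<Longrightarrow> resolvent A z (A \<cdot> x - z *\<^sub>C x) = x"
    using inv_into_f_f[OF inj] by (simp add: resolvent_def)
qed

text \<open>The constant in \<open>resolvent_set_on\<close> may have any sign; a positive one is
  needed for the perturbation radius \<open>1 / (2 * c)\<close>.\<close>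

lemma resolvent_set_bound:
  assumes "z \<in> resolvent_set A"
  obtains c where "c > 0" "\<And>x. x \<in> dom A \<Longrightarrow> norm x \<le> c * norm (A \<cdot> x - z *\<^sub>C x)"
proof -
  obtain c where c: "\<And>x. x \<in> dom A \<Longrightarrow> norm x \<le> c * norm (A \<cdot> x - z *\<^sub>C x)"
    using assms by (auto simp: resolvent_set_on_def)
  have "norm x \<le> (\<bar>c\<bar> + 1) * norm (A \<cdot> x - z *\<^sub>C x)" if "x \<in> dom A" for x
    using c[OF that] by (smt (verit) mult_right_mono norm_ge_zero)
  then show thesis
    using that[of "\<bar>c\<bar> + 1"] by simp
qed

lemma resolvent_diff:
  assumes "linear_op A" "z \<in> resolvent_set A"
  shows "resolvent A z (x - y) = resolvent A z x - resolvent A z y"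
proof -
  note R = resolvent_setD[OF assms(2)]
  have "resolvent A z x - resolvent A z y \<in> dom A"
    using R(2) linear_opD(1)[OF assms(1)] by (intro complex_vector.subspace_diff)
  then show ?thesis
    using R(4)[of "resolvent A z x - resolvent A z y"] R(2,3) shifted_diff[OF assms(1)] by simp
qed

section \<open>Perturbation, continuity and holomorphy of resolvents\<close>

text \<open>Within this radius the error \<open>(z - z0) *\<^sub>C x\<close> costs at most half of
  \<open>norm x\<close>, which is absorbed on the left by doubling the constant.\<close>

lemma perturbed_bound:
  assumes c: "c > 0" "norm x \<le> c * norm (A \<cdot> x - z0 *\<^sub>C x)" and z: "cmod (z - z0) < 1 / (2 * c)"
  shows "norm (x::'a::complex_inner) \<le> 2 * c * norm (A \<cdot> x - z *\<^sub>C x)"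
proof -
  have "A \<cdot> x - z0 *\<^sub>C x = (A \<cdot> x - z *\<^sub>C x) + (z - z0) *\<^sub>C x"
    by (simp add: complex_vector.scale_left_diff_distrib)
  then have "norm (A \<cdot> x - z0 *\<^sub>C x) \<le> norm (A \<cdot> x - z *\<^sub>C x) + cmod (z - z0) * norm x"
    by (metis norm_triangle_ineq norm_scaleC)
  also have "\<dots> \<le> norm (A \<cdot> x - z *\<^sub>C x) + 1 / (2 * c) * norm x"
    using z by (intro add_left_mono mult_right_mono) auto
  finally have "c * norm (A \<cdot> x - z0 *\<^sub>C x) \<le> c * (norm (A \<cdot> x - z *\<^sub>C x) + 1 / (2 * c) * norm x)"
    using c(1) by (intro mult_left_mono) auto
  also have "\<dots> = c * norm (A \<cdot> x - z *\<^sub>C x) + norm x / 2"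
    using c(1) by (simp add: field_simps)
  finally show ?thesis
    using c(2) by simp
qed

text \<open>The perturbed bound yields injectivity and a bounded inverse. Surjectivity comes from
  Banach's fixed point theorem, in place of a Neumann series.\<close>

lemma resolvent_set_ball:
  fixes A :: "'a::chilbert_space \<rightharpoonup> 'a"
  assumes lin: "linear_op A" and z0: "z0 \<in> resolvent_set A"
    and c: "c > 0" "\<And>x. x \<in> dom A \<Longrightarrow> norm x \<le> c * norm (A \<cdot> x - z0 *\<^sub>C x)"
    and z: "cmod (z - z0) < 1 / (2 * c)"
  shows "z \<in> resolvent_set A"
proof -
  note R = resolvent_setD[OF z0] and sub = linear_opD(1)[OF lin]
  have bound: "norm x \<le> 2 * c * norm (A \<cdot> x - z *\<^sub>C x)" if "x \<in> dom A" for x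
    using perturbed_bound c z that by blast
  have inj: "inj_on (\<lambda>x. A \<cdot> x - z *\<^sub>C x) (dom A)"
  proof (rule inj_onI)
    fix x y assume xy: "x \<in> dom A" "y \<in> dom A" "A \<cdot> x - z *\<^sub>C x = A \<cdot> y - z *\<^sub>C y"
    then have "x - y \<in> dom A" "A \<cdot> (x - y) - z *\<^sub>C (x - y) = 0"
      using complex_vector.subspace_diff[OF sub xy(1,2)] shifted_diff[OF lin xy(1,2)] by auto
    then show "x = y"
      using bound[of "x - y"] by simp
  qed
  have "\<exists>x\<in>dom A. A \<cdot> x - z *\<^sub>C x = y" for y
  proof -
    \<comment> \<open>A fixed point of \<open>F\<close> solves \<open>A x - z x = y\<close>, and
      \<open>c * cmod (z - z0) < 1/2\<close> makes \<open>F\<close> a contraction.\<close>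
    define F where "F = (\<lambda>x. resolvent A z0 (y + (z - z0) *\<^sub>C x))"
    have "dist (F x) (F x') \<le> 1/2 * dist x x'" for x x'
    proof -
      have "F x - F x' = resolvent A z0 ((z - z0) *\<^sub>C (x - x'))"
        unfolding F_def resolvent_diff[OF lin z0, symmetric]
        by (simp add: complex_vector.scale_right_diff_distrib)
      then have "dist (F x) (F x') \<le> c * norm ((z - z0) *\<^sub>C (x - x'))"
        using c(2)[OF R(2)] by (simp add: R(3) dist_norm)
      also have "\<dots> = (c * cmod (z - z0)) * dist x x'"
        by (simp add: norm_scaleC dist_norm)
      also have "\<dots> \<le> 1/2 * dist x x'"
        using z c(1) by (intro mult_right_mono) (auto simp: field_simps)
      finally show ?thesis .
    qed
    then obtain x where x: "F x = x"
      using banach_fix_type[of "1/2" F] by auto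
    have "A \<cdot> x - z0 *\<^sub>C x = y + (z - z0) *\<^sub>C x" "x \<in> dom A"
      using R(2,3)[of "y + (z - z0) *\<^sub>C x"] x by (simp_all add: F_def)
    then show ?thesis
      by (intro bexI[of _ x]) (auto simp: complex_vector.scale_left_diff_distrib algebra_simps)
  qed
  then have "y \<in> (\<lambda>x. A \<cdot> x - z *\<^sub>C x) ` dom A" for y
    unfolding image_iff by (simp only: eq_commute[of y])
  then have "bij_betw (\<lambda>x. A \<cdot> x - z *\<^sub>C x) (dom A) UNIV"
    unfolding bij_betw_def by (intro conjI inj UNIV_eq_I[symmetric])
  then show ?thesis
    unfolding resolvent_set_on_def using bound by blast
qed

lemma open_resolvent_set:
  fixes A :: "'a::chilbert_space \<rightharpoonup> 'a"
  assumes "linear_op A"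
  shows "open (resolvent_set A)"
proof (rule openI)
  fix z0 assume z0: "z0 \<in> resolvent_set A"
  obtain c where c: "c > 0" "\<And>x. x \<in> dom A \<Longrightarrow> norm x \<le> c * norm (A \<cdot> x - z0 *\<^sub>C x)"
    using resolvent_set_bound[OF z0] by blast
  have "ball z0 (1 / (2 * c)) \<subseteq> resolvent_set A"
    using resolvent_set_ball[OF assms z0 c] by (auto simp: dist_norm norm_minus_commute)
  then show "\<exists>e>0. ball z0 e \<subseteq> resolvent_set A"
    using c(1) by (intro exI[of _ "1 / (2 * c)"]) simp
qed

text \<open>Both sides lie in \<open>dom A\<close> and have the same image under the injective map
  \<open>A - z\<close>.\<close>

lemma resolvent_identity:
  assumes "linear_op A" "z \<in> resolvent_set A" "z0 \<in> resolvent_set A"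
  shows "resolvent A z y - resolvent A z0 y = (z - z0) *\<^sub>C resolvent A z (resolvent A z0 y)"
proof -
  note R = resolvent_setD[OF assms(2)] and R0 = resolvent_setD[OF assms(3)]
    and sub = linear_opD(1)[OF assms(1)]
  let ?x = "resolvent A z y - resolvent A z0 y" and ?r = "resolvent A z (resolvent A z0 y)"
  have x: "?x \<in> dom A" and r: "(z - z0) *\<^sub>C ?r \<in> dom A"
    by (rule complex_vector.subspace_diff[OF sub R(2) R0(2)], rule complex_vector.subspace_scale[OF sub R(2)])
  have "A \<cdot> ?x - z *\<^sub>C ?x = y - (A \<cdot> resolvent A z0 y - z *\<^sub>C resolvent A z0 y)"
    using R(2,3) R0(2) shifted_diff[OF assms(1)] by simp
  also have "\<dots> = y - (A \<cdot> resolvent A z0 y - z0 *\<^sub>C resolvent A z0 y) + (z - z0) *\<^sub>C resolvent A z0 y"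
    by (simp add: complex_vector.scale_left_diff_distrib)
  also have "\<dots> = (z - z0) *\<^sub>C resolvent A z0 y"
    by (simp add: R0(3))
  also have "\<dots> = A \<cdot> ((z - z0) *\<^sub>C ?r) - z *\<^sub>C ((z - z0) *\<^sub>C ?r)"
    using R(2,3) shifted_scale[OF assms(1)] by simp
  finally show ?thesis
    by (rule inj_onD[OF R(1) _ x r])
qed

text \<open>By the resolvent identity the difference is \<open>z - z0\<close> times the resolvent at
  \<open>z\<close> of a fixed vector, and \<open>perturbed_bound\<close> controls the latter
  uniformly for \<open>z\<close> near \<open>z0\<close>.\<close>

lemma Lim_resolvent:
  fixes A :: "'a::chilbert_space \<rightharpoonup> 'a"
  assumes lin: "linear_op A" and z0: "z0 \<in> resolvent_set A"
  shows "((\<lambda>z. resolvent A z y) \<longlongrightarrow> resolvent A z0 y) (at z0)"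
proof -
  obtain c where c: "c > 0" "\<And>x. x \<in> dom A \<Longrightarrow> norm x \<le> c * norm (A \<cdot> x - z0 *\<^sub>C x)"
    using resolvent_set_bound[OF z0] by blast
  define K where "K = 2 * c * norm (resolvent A z0 y)"
  have "norm (resolvent A z y - resolvent A z0 y) \<le> cmod (z - z0) * K"
    if z: "cmod (z - z0) < 1 / (2 * c)" for z
  proof -
    have zA: "z \<in> resolvent_set A"
      by (rule resolvent_set_ball[OF lin z0 c z])
    note R = resolvent_setD[OF zA]
    have "norm (resolvent A z (resolvent A z0 y)) \<le> K"
      using perturbed_bound[where A = A, OF c(1) c(2)[OF R(2)[of "resolvent A z0 y"]] z]
      by (simp add: R(3) K_def)
    then show ?thesis
      unfolding resolvent_identity[OF lin zA z0] norm_scaleC by (simp add: mult_left_mono)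
  qed
  then have ev: "eventually (\<lambda>z. norm (resolvent A z y - resolvent A z0 y) \<le> cmod (z - z0) * K) (at z0)"
    using c(1) unfolding eventually_at
    by (intro exI[of _ "1 / (2 * c)"]) (simp add: dist_norm)
  have "((\<lambda>z. cmod (z - z0) * K) \<longlongrightarrow> cmod (z0 - z0) * K) (at z0)"
    by (intro tendsto_intros)
  then have "((\<lambda>z. resolvent A z y - resolvent A z0 y) \<longlongrightarrow> 0) (at z0)"
    by (intro Lim_null_comparison[OF ev]) simp
  then show ?thesis
    using LIM_zero_iff by blast
qed

text \<open>By polarization, continuity of the scalar product follows from that of the norm.\<close>

lemma tendsto_cinner_left:
  fixes f :: "'b \<Rightarrow> 'a::complex_inner"
  assumes f: "(f \<longlongrightarrow> l) F"
  shows "((\<lambda>z. cinner (f z) w) \<longlongrightarrow> cinner l w) F"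
proof -
  have Re: "Re (cinner x v) = ((norm (x + v))\<^sup>2 - (norm x)\<^sup>2 - (norm v)\<^sup>2) / 2" for x v :: 'a
    unfolding norm_add_squared by simp
  have Im: "Im (cinner x w) = Re (cinner x (\<i> *\<^sub>C w))" for x
    by (simp add: cinner_scaleC_right)
  show ?thesis
    unfolding tendsto_complex_iff Im Re by (intro conjI tendsto_intros f) auto
qed

text \<open>The resolvent identity turns the difference quotient at \<open>z0\<close> into
  \<open>cinner (resolvent A z ?r) w\<close>, which is continuous in \<open>z\<close> at
  \<open>z0\<close>. Passing to scalar functions is enough for the identity theorem.\<close>

lemma holomorphic_resolvent:
  fixes A :: "'a::chilbert_space \<rightharpoonup> 'a"
  assumes lin: "linear_op A"
  shows "(\<lambda>z. cinner (resolvent A z y) w) holomorphic_on resolvent_set A"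
  unfolding holomorphic_on_open[OF open_resolvent_set[OF lin]]
proof (intro ballI exI)
  fix z0 assume z0: "z0 \<in> resolvent_set A"
  let ?r = "resolvent A z0 y"
  have lim: "((\<lambda>z. cinner (resolvent A z ?r) w) \<longlongrightarrow> cinner (resolvent A z0 ?r) w) (at z0)"
    by (intro tendsto_cinner_left Lim_resolvent[OF lin z0])
  have "eventually (\<lambda>z. z \<in> resolvent_set A) (at z0)"
    using open_resolvent_set[OF lin] z0 by (rule eventually_at_in_open')
  then have "eventually (\<lambda>z. cinner (resolvent A z ?r) w
      = (cinner (resolvent A z y) w - cinner (resolvent A z0 y) w) / (z - z0)) (at z0)"
    using eventually_neq_at_within[of z0]
  proof eventually_elim
    case (elim z)
    then show ?case
      unfolding cinner_diff_left[symmetric] resolvent_identity[OF lin elim(1) z0]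
      by (simp add: cinner_scaleC_left)
  qed
  then show "((\<lambda>z. cinner (resolvent A z y) w) has_field_derivative
      cinner (resolvent A z0 ?r) w) (at z0)"
    unfolding has_field_derivative_iff by (rule Lim_transform_eventually[OF lim])
qed

section \<open>Subspaces invariant under the resolvent\<close>

text \<open>An injective linear endomorphism of a finite-dimensional space is onto, by counting
  basis vectors.\<close>

lemma bij_on_finite_dim_subspace:
  assumes lin: "linear_op T" and z: "inj_on (\<lambda>x. T \<cdot> x - z *\<^sub>C x) (dom T)"
    and W: "csubspace W" "W \<subseteq> V" "cfinite_dim V" "W \<subseteq> dom T" and inv: "invariant_under T W"
    and x: "x \<in> W"
  shows "\<exists>y\<in>W. T \<cdot> y - z *\<^sub>C y = x"
proof -
  interpret pair: vector_space_pair
    "scaleC :: complex \<Rightarrow> 'a \<Rightarrow> 'a" "scaleC :: complex \<Rightarrow> 'a \<Rightarrow> 'a" ..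
  obtain S where S: "finite S" "cspan S = V"
    using W(3) by (auto simp: cfinite_dim_def)
  obtain E where E: "E \<subseteq> W" "complex_vector.independent E" "cspan E = W"
    using complex_vector.maximal_independent_subset[of W] complex_vector.span_subspace W(1) by metis
  have finE: "finite E"
    using complex_vector.independent_span_bound[OF S(1) E(2)] E(1) W(2) S(2) by auto
  let ?f = "\<lambda>x. T \<cdot> x - z *\<^sub>C x"
  \<comment> \<open>A total linear map that agrees with the partially defined \<open>T - z\<close>
    on \<open>W\<close>, so that the theory of linear maps between vector spaces applies.\<close>
  define g where "g = pair.construct E ?f"
  have lin_g: "Vector_Spaces.linear (*\<^sub>C) (*\<^sub>C) g"
    unfolding g_def by (rule pair.linear_construct[OF E(2)])
  interpret g: Vector_Spaces.linear "(*\<^sub>C)" "(*\<^sub>C)" g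
    by (rule lin_g)
  have sub_dom: "cspan E \<subseteq> dom T"
    using E(3) W(4) by simp
  have gf: "x \<in> dom T \<and> g x = ?f x" if "x \<in> cspan E" for x
    using that
  proof (induction rule: complex_vector.span_induct_alt)
    case base
    show ?case
      using sub_dom complex_vector.span_zero linear_op_zero[OF lin] by (auto simp: g.zero)
  next
    case (step c e y)
    then have e: "e \<in> dom T" "g e = ?f e"
      using E(1) W(4) pair.construct_basis[OF E(2)] by (auto simp: g_def)
    have ce: "c *\<^sub>C e \<in> dom T"
      using e(1) linear_opD(1)[OF lin] by (rule complex_vector.subspace_scale[rotated])
    then have "c *\<^sub>C e + y \<in> dom T"
      using step complex_vector.subspace_add[OF linear_opD(1)[OF lin]] by simp
    then show ?case
      using step e ce shifted_add[OF lin ce, of y z] shifted_scale[OF lin e(1), of c z]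
      by (simp only: g.add g.scale simp_thms)
  qed
  have fW: "?f x \<in> W" if "x \<in> W" for x
    using that inv W(1,4)
    by (intro complex_vector.subspace_diff complex_vector.subspace_scale) (auto simp: invariant_under_def)
  have inj: "inj_on g (cspan E)"
    using inj_on_subset[OF z sub_dom] gf by (simp add: inj_on_def)
  then have ind: "complex_vector.independent (g ` E)"
    using g.independent_inj_on_image[OF E(2)] by (simp add: cspan_def)
  have gE: "g ` E \<subseteq> W"
    using fW gf E by (auto simp: complex_vector.span_base)
  have "card (g ` E) = card E"
    using inj by (meson card_image complex_vector.span_superset inj_on_subset)
  \<comment> \<open>The images of the basis under \<open>g\<close> are \<open>card E\<close>
    independent vectors of \<open>W\<close>. A vector of \<open>W\<close> outside their span would
    enlarge them to an independent set with more than \<open>card E\<close> elements.\<close>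
  have "x \<in> cspan (g ` E)"
  proof (rule ccontr)
    assume nx: "x \<notin> cspan (g ` E)"
    then have "complex_vector.independent (insert x (g ` E))"
      using ind by (simp add: complex_vector.independent_insert)
    moreover have "insert x (g ` E) \<subseteq> cspan E"
      using x gE E(3) by auto
    ultimately have "card (insert x (g ` E)) \<le> card E"
      using complex_vector.independent_span_bound[OF finE] by blast
    moreover have "x \<notin> g ` E"
      using nx complex_vector.span_base[of x "g ` E"] by metis
    ultimately show False
      using \<open>card (g ` E) = card E\<close> finE by simp
  qed
  then obtain y where "y \<in> cspan E" "x = g y"
    using g.span_image[of E] unfolding cspan_def by (metis imageE)
  then show ?thesis
    using gf E(3) by auto
qed

text \<open>Finite dimension settles the matter on each piece of \<open>U\<close>, linearity carries
  it to the algebraic sum, and boundedness of the inverse to the closure, which is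
  \<open>U\<close>.\<close>

lemma resolvent_invariant_subspace:
  assumes lin: "linear_op T" and z: "z \<in> resolvent_set T"
    and V: "\<And>k. cfinite_dim (V k)" "\<And>k. V k \<subseteq> dom T" "\<And>k. invariant_under T (V k)"
    and U: "csubspace U" "invariant_under T U" "compatible_with V U"
    and x: "x \<in> U"
  shows "resolvent T z x \<in> U"
proof -
  note R = resolvent_setD[OF z]
  obtain W where W: "\<And>k. csubspace (W k)" "\<And>k. W k \<subseteq> V k" "U = closure (cspan (\<Union>k. W k))"
    using U(3) by (auto simp: compatible_with_def)
  have W_U: "W k \<subseteq> U" for k
    unfolding W(3) using closure_subset complex_vector.span_superset by (meson UN_upper UNIV_I order_trans)
  \<comment> \<open>Compatibility says nothing about \<open>T\<close>-invariance of the spaces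
    \<open>W k\<close>. The intersections \<open>U \<inter> V k\<close>, which contain them, are
    invariant because \<open>U\<close> and \<open>V k\<close> are.\<close>
  have on_VU: "\<exists>y\<in>U \<inter> V k. T \<cdot> y - z *\<^sub>C y = x" if "x \<in> W k" for x k
  proof (rule bij_on_finite_dim_subspace[OF lin R(1), where V = "V k"])
    obtain S where "cspan S = V k"
      using V(1)[of k] by (auto simp: cfinite_dim_def)
    then have "csubspace (V k)"
      using complex_vector.subspace_span by metis
    then show "csubspace (U \<inter> V k)"
      using U(1) by (rule complex_vector.subspace_inter[rotated])
    show "invariant_under T (U \<inter> V k)"
      using U(2) V(3)[of k] by (auto simp: invariant_under_def)
    show "x \<in> U \<inter> V k"
      using that W_U W(2) by blast
  qed (use V in auto)
  define P where "P = {x. resolvent T z x \<in> U}"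
  have "csubspace P"
    unfolding complex_vector.subspace_def
  proof (intro conjI allI ballI)
    have "resolvent T z 0 = 0"
      using resolvent_diff[OF lin z, of 0 0] by simp
    then show "0 \<in> P"
      using U(1) by (simp add: P_def complex_vector.subspace_0)
  next
    fix x y assume "x \<in> P" "y \<in> P"
    moreover have "resolvent T z (x + y) = resolvent T z x + resolvent T z y"
      using resolvent_diff[OF lin z, of "x + y" y] by simp
    ultimately show "x + y \<in> P"
      using U(1) by (simp add: P_def complex_vector.subspace_add)
  next
    fix a x assume "x \<in> P"
    moreover have "resolvent T z (a *\<^sub>C x) = a *\<^sub>C resolvent T z x"
      using R(4)[of "a *\<^sub>C resolvent T z x"] shifted_scale[OF lin R(2), where a = a and z = z] R(3)
        complex_vector.subspace_scale[OF linear_opD(1)[OF lin] R(2)] by simp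
    ultimately show "a *\<^sub>C x \<in> P"
      using U(1) by (simp add: P_def complex_vector.subspace_scale)
  qed
  moreover have "(\<Union>k. W k) \<subseteq> P"
  proof
    fix x assume "x \<in> (\<Union>k. W k)"
    then obtain k y where y: "y \<in> U \<inter> V k" "T \<cdot> y - z *\<^sub>C y = x"
      using on_VU by blast
    then have "resolvent T z x = y"
      using R(4)[of y] V(2)[of k] by blast
    then show "x \<in> P"
      using y(1) by (simp add: P_def)
  qed
  ultimately have span_P: "cspan (\<Union>k. W k) \<subseteq> P"
    by (rule complex_vector.span_minimal[rotated])
  obtain s where s: "\<And>n. s n \<in> cspan (\<Union>k. W k)" "s \<longlonglongrightarrow> x"
    using x W(3) closure_sequential by blast
  obtain c where c: "c > 0" "\<And>x. x \<in> dom T \<Longrightarrow> norm x \<le> c * norm (T \<cdot> x - z *\<^sub>C x)"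
    using resolvent_set_bound[OF z] by blast
  \<comment> \<open>The preimages under \<open>T - z\<close> converge along with \<open>s\<close>,
    so closedness of \<open>U\<close> finishes the argument.\<close>
  have le: "norm (resolvent T z (s n) - resolvent T z x) \<le> c * norm (s n - x)" for n
    using c(2)[OF R(2)[of "s n - x"]] unfolding R(3) by (simp add: resolvent_diff[OF lin z])
  have "(\<lambda>n. c * norm (s n - x)) \<longlonglongrightarrow> 0"
    using tendsto_mult_left[OF tendsto_norm[OF LIM_zero[OF s(2)]], of c] by simp
  with always_eventually[OF allI, OF le]
  have "(\<lambda>n. resolvent T z (s n) - resolvent T z x) \<longlonglongrightarrow> 0"
    by (rule Lim_null_comparison)
  then have "(\<lambda>n. resolvent T z (s n)) \<longlonglongrightarrow> resolvent T z x"
    by (rule LIM_zero_cancel)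
  moreover have "resolvent T z (s n) \<in> U" for n
    using s(1) span_P by (auto simp: P_def)
  ultimately show ?thesis
    unfolding W(3) by (rule closed_sequentially[OF closed_closure, rotated])
qed


section \<open>Graphs and neutral subspaces\<close>

text \<open>Two values at the same \<open>u\<close> differ by some \<open>w\<close> with
  \<open>(0, w)\<close> in \<open>U\<close>, so the absence of nonzero vertical vectors is exactly
  single-valuedness.\<close>

lemma subspace_is_operator_graph:
  fixes U :: "('a::complex_inner \<times> 'b::complex_inner) set"
  assumes U: "csubspace U" and single: "\<And>w. (0, w) \<in> U \<Longrightarrow> w = 0"
  obtains X where "linear_op X" "Map.graph X = U"
proof -
  have uniq: "v = v'" if "(u, v) \<in> U" "(u, v') \<in> U" for u v v'
    using complex_vector.subspace_diff[OF U that] single[of "v - v'"] by simp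
  define X where "X u = (if \<exists>v. (u, v) \<in> U then Some (SOME v. (u, v) \<in> U) else None)" for u
  have X: "X u = Some v \<longleftrightarrow> (u, v) \<in> U" for u v
    using uniq by (auto simp: X_def intro: someI2_ex)
  have zero: "X 0 = Some 0"
    using complex_vector.subspace_0[OF U] by (simp add: X zero_prod_def)
  have add: "X (u + u') = Some (v + v')" if "X u = Some v" "X u' = Some v'" for u u' v v'
    using complex_vector.subspace_add[OF U] that by (fastforce simp: X)
  have scale: "X (a *\<^sub>C u) = Some (a *\<^sub>C v)" if "X u = Some v" for a u v
    using complex_vector.subspace_scale[OF U, of "(u, v)" a] that by (simp add: X scaleC_prod_def)
  have "linear_op X"
    unfolding linear_op_def complex_vector.subspace_def
    using zero by (auto simp: add scale dom_def)
  moreover have "Map.graph X = U"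
    by (auto simp: Map.graph_def X)
  ultimately show thesis by (rule that)
qed

lemma cinner_J1: "cinner (J1 (a, b)) (c, d) = \<i> * (cinner a d - cinner b c)"
  by (simp add: J1_def cinner_prod_def cinner_minus_left cinner_scaleC_left algebra_simps)

text \<open>The factor \<open>\<i>\<close> cancels. If \<open>U\<close> is the graph of a densely
  defined \<open>X\<close>, the right-hand side says that \<open>(a, b)\<close> belongs to the graph
  of the adjoint of \<open>X\<close>.\<close>

lemma in_hypermaximal_iff:
  assumes "hypermaximal_J1_neutral U"
  shows "(a, b) \<in> U \<longleftrightarrow> (\<forall>(c, d)\<in>U. cinner a d = cinner b c)"
proof -
  have "(a, b) \<in> U \<longleftrightarrow> (\<forall>y\<in>U. cinner (J1 (a, b)) y = 0)"
    using assms unfolding hypermaximal_J1_neutral_def by blast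
  then show ?thesis
    by (auto simp: cinner_J1)
qed

lemma selfadjoint_if_graph_hypermaximal:
  fixes X :: "'a::chilbert_space \<rightharpoonup> 'a"
  assumes lin: "linear_op X" and hyp: "hypermaximal_J1_neutral (Map.graph X)"
  shows "selfadjoint_op X"
proof -
  have graph: "X a = Some b \<longleftrightarrow> (\<forall>c\<in>dom X. cinner a (X \<cdot> c) = cinner b c)" for a b
    using in_hypermaximal_iff[OF hyp, of a b] by (auto simp: Map.graph_def dom_def)
  have dense: "closure (dom X) = UNIV"
  \<comment> \<open>A vector \<open>w\<close> orthogonal to the domain satisfies the neutrality
    condition for \<open>(0, w)\<close>, hence is the value of \<open>X\<close> at
    \<open>0\<close>.\<close>
  proof (rule dense_if_orthogonal_complement_trivial[OF linear_opD(1)[OF lin]])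
    fix w assume "\<And>u. u \<in> dom X \<Longrightarrow> cinner u w = 0"
    then have "X 0 = Some w"
      by (simp add: graph cinner_eq_zero_commute[of w])
    then show "w = 0"
      using linear_op_zero[OF lin] by simp
  qed
  then have dd: "densely_defined X"
    by (simp add: densely_defined_def)
  have "cinner (X \<cdot> c) v = cinner c w \<longleftrightarrow> cinner v (X \<cdot> c) = cinner w c" for c v w
    unfolding cinner_commute[of "X \<cdot> c" v] cinner_commute[of c w] by simp
  then have "adjoint_op X v = Some w \<longleftrightarrow> X v = Some w" for v w
    unfolding adjoint_op_eq_Some_iff[OF dd] graph by simp
  then have "adjoint_op X v = X v" for v
    by (metis option.exhaust)
  then have "adjoint_op X = X" ..
  then show ?thesis
    using lin dd by (simp add: selfadjoint_op_def)
qed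


section \<open>Hamiltonian operator matrices\<close>

lemma hamiltonian_matrix_dominant:
  fixes A B C :: "'a::complex_inner \<rightharpoonup> 'a"
  assumes "diagonally_dominant A B C"
  shows "dom (hamiltonian_matrix A B C) = dom A \<times> dom (adjoint_op A)"
    and "u \<in> dom A \<Longrightarrow> v \<in> dom (adjoint_op A)
      \<Longrightarrow> hamiltonian_matrix A B C \<cdot> (u, v) = (A \<cdot> u + B \<cdot> v, C \<cdot> u - adjoint_op A \<cdot> v)"
proof -
  have sub: "dom A \<inter> dom C = dom A" "dom (adjoint_op A) \<inter> dom B = dom (adjoint_op A)"
    using assms unfolding diagonally_dominant_def rel_bounded_def by blast+
  have eq: "hamiltonian_matrix A B C (u, v) =
      (if u \<in> dom A \<and> v \<in> dom (adjoint_op A)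
       then Some (A \<cdot> u + B \<cdot> v, C \<cdot> u - adjoint_op A \<cdot> v) else None)" for u v
    unfolding hamiltonian_matrix_def sub by simp
  show "dom (hamiltonian_matrix A B C) = dom A \<times> dom (adjoint_op A)"
  proof (rule set_eqI)
    fix x :: "'a \<times> 'a"
    show "x \<in> dom (hamiltonian_matrix A B C) \<longleftrightarrow> x \<in> dom A \<times> dom (adjoint_op A)"
      by (cases x) (simp add: domIff eq del: not_None_eq)
  qed
  show "u \<in> dom A \<Longrightarrow> v \<in> dom (adjoint_op A)
      \<Longrightarrow> hamiltonian_matrix A B C \<cdot> (u, v) = (A \<cdot> u + B \<cdot> v, C \<cdot> u - adjoint_op A \<cdot> v)"
    by (simp only: eq simp_thms if_True option.sel)
qed

lemma csubspace_riccati_domain: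
  assumes A: "linear_op A" "densely_defined A" and X: "linear_op X"
  shows "csubspace (riccati_domain A X)"
proof -
  note sub = linear_opD(1)[OF A(1)] linear_opD(1)[OF X] linear_opD(1)[OF linear_op_adjoint[OF A(2)]]
  have mem: "u \<in> riccati_domain A X \<longleftrightarrow> u \<in> dom A \<and> u \<in> dom X \<and> X \<cdot> u \<in> dom (adjoint_op A)" for u
    unfolding riccati_domain_def by blast
  show ?thesis
  proof (rule complex_vector.subspaceI)
    show "0 \<in> riccati_domain A X"
      unfolding mem linear_op_zero[OF X] by (intro conjI sub[THEN complex_vector.subspace_0])
    fix u assume "u \<in> riccati_domain A X"
    then have u: "u \<in> dom A" "u \<in> dom X" "X \<cdot> u \<in> dom (adjoint_op A)"
      unfolding mem by blast+
    show "a *\<^sub>C u \<in> riccati_domain A X" for a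
      unfolding mem linear_opD(3)[OF X u(2)]
      by (intro conjI sub[THEN complex_vector.subspace_scale] u)
    fix v assume "v \<in> riccati_domain A X"
    then have v: "v \<in> dom A" "v \<in> dom X" "X \<cdot> v \<in> dom (adjoint_op A)"
      unfolding mem by blast+
    show "u + v \<in> riccati_domain A X"
      unfolding mem linear_opD(2)[OF X u(2) v(2)]
      by (intro conjI sub[THEN complex_vector.subspace_add] u v)
  qed
qed

section \<open>Vertical vectors in a hypermaximal neutral subspace\<close>

text \<open>Only the second component \<open>v\<close> of the preimage is kept, since
  \<open>C u = 0\<close> removes \<open>u\<close> from the second row. It may depend on
  \<open>z\<close> whereas \<open>w\<close> does not, which is what varying \<open>z\<close>
  exploits later.\<close>

lemma neutral_resolvent_preimage:
  assumes ham: "hamiltonian A B C" and nonneg: "nonneg_op B" "nonneg_op C"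
    and dd: "diagonally_dominant A B C"
    and z: "z \<in> resolvent_set (hamiltonian_matrix A B C)" "z \<in> imaginary_axis"
    and U: "hypermaximal_J1_neutral U" "(0, w) \<in> U"
      "resolvent (hamiltonian_matrix A B C) z (0, w) \<in> U"
  obtains v where "v \<in> dom (adjoint_op A)" "w = - (adjoint_op A \<cdot> v) - z *\<^sub>C v" "B \<cdot> v = 0"
proof -
  let ?T = "hamiltonian_matrix A B C"
  have symB: "symmetric_op B" and symC: "symmetric_op C" and dA: "densely_defined A"
    using ham by (auto simp: hamiltonian_def)
  obtain u v where uv: "resolvent ?T z (0, w) = (u, v)" by fastforce
  note R = resolvent_setD[OF z(1)]
  have u: "u \<in> dom A" and v: "v \<in> dom (adjoint_op A)"
    using R(2)[of "(0, w)"] by (auto simp only: uv hamiltonian_matrix_dominant(1)[OF dd])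
  then have uC: "u \<in> dom C" and vB: "v \<in> dom B"
    using dd by (auto simp: diagonally_dominant_def rel_bounded_def)
  have eqs: "A \<cdot> u + B \<cdot> v - z *\<^sub>C u = 0" "C \<cdot> u - adjoint_op A \<cdot> v - z *\<^sub>C v = w"
    using R(3)[of "(0, w)"]
    by (simp_all add: uv hamiltonian_matrix_dominant(2)[OF dd u v] scaleC_prod_def)
  \<comment> \<open>This is where the imaginary axis enters: the terms with \<open>A\<close> and
    \<open>z\<close> combine to \<open>- cinner (A \<cdot> u - z *\<^sub>C u) v\<close>, which the
    first row identifies with \<open>cinner (B \<cdot> v) v\<close>.\<close>
  have cnj_z: "cnj z = - z"
    using z(2) by (auto simp: imaginary_axis_def)
  have Bv: "B \<cdot> v = - (A \<cdot> u - z *\<^sub>C u)"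
    using eqs(1) by (metis add_diff_eq add.commute eq_neg_iff_add_eq_0)
  \<comment> \<open>Neutrality is applied to the pair \<open>(u, v)\<close> and
    \<open>(0, w)\<close>, both in \<open>U\<close>.\<close>
  have "cinner u w = cinner v 0"
    using in_hypermaximal_iff[OF U(1), of u v] U(2,3) uv by auto
  then have "0 = cinner u w" by simp
  also have "\<dots> = cinner u (C \<cdot> u) - cinner (A \<cdot> u) v + z * cinner u v"
    unfolding eqs(2)[symmetric] by (simp add: cinner_diff_right cinner_scaleC_right cnj_z
        adjoint_op_cinner[OF dA u v])
  also have "\<dots> = cinner (C \<cdot> u) u + cinner (B \<cdot> v) v"
    using symC uC unfolding Bv
    by (simp add: symmetric_op_def cinner_minus_left cinner_diff_left cinner_scaleC_left)
  finally have sum0: "cinner (C \<cdot> u) u + cinner (B \<cdot> v) v = 0" ..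
  have re: "0 \<le> Re (cinner (C \<cdot> u) u)" "0 \<le> Re (cinner (B \<cdot> v) v)"
    and im: "Im (cinner (C \<cdot> u) u) = 0" "Im (cinner (B \<cdot> v) v) = 0"
    using nonneg uC vB by (auto simp: nonneg_op_def complex_is_Real_iff)
  have "Re (cinner (C \<cdot> u) u) + Re (cinner (B \<cdot> v) v) = 0"
    using sum0 by (metis plus_complex.simps(1) zero_complex.simps(1))
  then have "cinner (C \<cdot> u) u = 0" "cinner (B \<cdot> v) v = 0"
    using re im by (simp_all add: complex_eq_iff)
  then have zero: "C \<cdot> u = 0" "B \<cdot> v = 0"
    using nonneg_symmetric_op_eq_zero symB symC nonneg uC vB by blast+
  show thesis
    using that[OF v] eqs(2) zero by (simp add: algebra_simps)
qed

text \<open>Because \<open>cnj z = - z\<close>, the shifted adjoint moves to the left factor as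
  \<open>A - z\<close> and cancels the resolvent. What remains is the pairing of \<open>u\<close>
  with \<open>B \<cdot> v = 0\<close>.\<close>

lemma adjoint_shifted_kernel_orthogonal:
  assumes "densely_defined A" "densely_defined B" "z \<in> resolvent_set A" "cnj z = - z"
    and "v \<in> dom (adjoint_op A)" "v \<in> dom B" "B \<cdot> v = 0" "u \<in> dom (adjoint_op B)"
  shows "cinner (resolvent A z (adjoint_op B \<cdot> u)) (- (adjoint_op A \<cdot> v) - z *\<^sub>C v) = 0"
proof -
  let ?x = "resolvent A z (adjoint_op B \<cdot> u)"
  note R = resolvent_setD[OF assms(3)]
  have "cinner ?x (- (adjoint_op A \<cdot> v) - z *\<^sub>C v) = - cinner (A \<cdot> ?x - z *\<^sub>C ?x) v"
    using adjoint_op_cinner[OF assms(1) R(2) assms(5)] assms(4)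
    by (simp add: cinner_diff_left cinner_diff_right cinner_minus_right cinner_scaleC_left
        cinner_scaleC_right)
  also have "\<dots> = - cinner (adjoint_op B \<cdot> u) v"
    by (simp only: R(3))
  also have "\<dots> = 0"
    using adjoint_op_cinner[OF assms(2,6,8)] assms(7)
    by (simp add: cinner_eq_zero_commute[of _ v])
  finally show ?thesis .
qed

text \<open>Supplies the accumulation point for the identity theorem: a line has no isolated points,
  and intersecting it with an open set creates none.\<close>

lemma islimpt_imaginary_axis:
  assumes "open S" "z \<in> S \<inter> imaginary_axis"
  shows "z islimpt S \<inter> imaginary_axis"
proof -
  have "z islimpt imaginary_axis"
    unfolding islimpt_approachable
  proof (intro allI impI)
    fix e :: real assume e: "0 < e"
    obtain t where t: "z = \<i> * complex_of_real t"
      using assms(2) by (auto simp: imaginary_axis_def)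
    have "\<i> * complex_of_real (t + e / 2) - z = \<i> * complex_of_real (e / 2)"
      unfolding t by (simp add: distrib_left)
    then have "dist (\<i> * complex_of_real (t + e / 2)) z = e / 2"
      using e by (simp only: dist_norm norm_mult norm_ii norm_of_real)
    then show "\<exists>x'\<in>imaginary_axis. x' \<noteq> z \<and> dist x' z < e"
      unfolding imaginary_axis_def using e t
      by (intro bexI[OF _ rangeI[of _ "t + e / 2"]]) auto
  qed
  show ?thesis
  proof (rule islimptI)
    fix X assume "z \<in> X" "open X"
    then have "z \<in> S \<inter> X" "open (S \<inter> X)"
      using assms by auto
    with \<open>z islimpt imaginary_axis\<close> obtain y where "y \<in> imaginary_axis" "y \<in> S \<inter> X" "y \<noteq> z"
      by (rule islimptE)
    then show "\<exists>y\<in>S \<inter> imaginary_axis. y \<in> X \<and> y \<noteq> z"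
      by auto
  qed
qed

lemma neutral_vertical_part_trivial:
  fixes A B C :: "'h::chilbert_space \<rightharpoonup> 'h"
  assumes ham: "hamiltonian A B C" and T: "T = hamiltonian_matrix A B C" "linear_op T"
    and nonneg: "nonneg_op B" "nonneg_op C" and dd: "diagonally_dominant A B C"
    and resolvent_T: "resolvent_set T \<inter> imaginary_axis \<noteq> {}"
    and a_or_b: "positive_op B \<or>
      (\<exists>M \<in> components (resolvent_set A).
        M \<inter> resolvent_set T \<inter> imaginary_axis \<noteq> {} \<and>
        closure (cspan {resolvent A z (adjoint_op B \<cdot> u) | z u. z \<in> M \<and> u \<in> dom (adjoint_op B)})
          = UNIV)"
    and U: "hypermaximal_J1_neutral U"
      "\<And>z x. z \<in> resolvent_set T \<Longrightarrow> x \<in> U \<Longrightarrow> resolvent T z x \<in> U"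
    and w: "(0, w) \<in> U"
  shows "w = 0"
proof -
  have linA: "linear_op A" and dA: "densely_defined A" and dB: "densely_defined B"
    using ham by (auto simp: hamiltonian_def symmetric_op_def)
  have domB: "dom (adjoint_op A) \<subseteq> dom B"
    using dd by (simp add: diagonally_dominant_def rel_bounded_def)
  have preimage: "\<exists>v. v \<in> dom (adjoint_op A) \<and> w = - (adjoint_op A \<cdot> v) - z *\<^sub>C v \<and> B \<cdot> v = 0"
    if "z \<in> resolvent_set T" "z \<in> imaginary_axis" for z
    using neutral_resolvent_preimage[OF ham nonneg dd, of z U w] that U w T(1) by metis
  show ?thesis
    using a_or_b
  proof
    assume pos: "positive_op B"
    obtain z where "z \<in> resolvent_set T" "z \<in> imaginary_axis"
      using resolvent_T by blast
    then obtain v where v: "v \<in> dom (adjoint_op A)" "w = - (adjoint_op A \<cdot> v) - z *\<^sub>C v" "B \<cdot> v = 0"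
      using preimage by blast
    have "v = 0"
    proof (rule ccontr)
      assume "v \<noteq> 0"
      then have "0 < Re (cinner (B \<cdot> v) v)"
        using pos v(1) domB unfolding positive_op_def by blast
      then show False by (simp add: v(3))
    qed
    then show ?thesis
      using v(2) linear_op_zero[OF linear_op_adjoint[OF dA]] by simp
  next
    assume "\<exists>M \<in> components (resolvent_set A).
        M \<inter> resolvent_set T \<inter> imaginary_axis \<noteq> {} \<and>
        closure (cspan {resolvent A z (adjoint_op B \<cdot> u) | z u. z \<in> M \<and> u \<in> dom (adjoint_op B)})
          = UNIV"
    then obtain M z0 where M: "M \<in> components (resolvent_set A)"
      and z0: "z0 \<in> M \<inter> resolvent_set T \<inter> imaginary_axis"
      and dense: "closure (cspan {resolvent A z (adjoint_op B \<cdot> u) | z u.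
        z \<in> M \<and> u \<in> dom (adjoint_op B)}) = UNIV"
      by blast
    have open_M: "open M" and MA: "M \<subseteq> resolvent_set A" and conn: "connected M"
      using M open_components open_resolvent_set[OF linA] in_components_subset
        in_components_connected by blast+
    \<comment> \<open>Both \<open>M\<close> and the resolvent set of \<open>T\<close> are open, so
      the given point \<open>z0\<close> is not isolated in the set of zeros found below.\<close>
    have lim: "z0 islimpt M \<inter> resolvent_set T \<inter> imaginary_axis"
      using z0 open_M open_resolvent_set[OF T(2)] by (intro islimpt_imaginary_axis) auto
    \<comment> \<open>For fixed \<open>u\<close> and \<open>w\<close> this is a holomorphic function
      of \<open>z\<close> on the connected open set \<open>M\<close>; a fresh \<open>v\<close> at
      each point of the imaginary axis shows that it vanishes there.\<close>
    have vanish: "cinner (resolvent A z (adjoint_op B \<cdot> u)) w = 0"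
      if z: "z \<in> M" and u: "u \<in> dom (adjoint_op B)" for z u
    proof (rule analytic_continuation[OF _ open_M conn _ _ lim _ z])
      show "(\<lambda>z. cinner (resolvent A z (adjoint_op B \<cdot> u)) w) holomorphic_on M"
        using holomorphic_resolvent[OF linA] MA by (rule holomorphic_on_subset)
      fix z' assume z': "z' \<in> M \<inter> resolvent_set T \<inter> imaginary_axis"
      then obtain v where v: "v \<in> dom (adjoint_op A)" "w = - (adjoint_op A \<cdot> v) - z' *\<^sub>C v" "B \<cdot> v = 0"
        using preimage by blast
      have vB: "v \<in> dom B" and z'A: "z' \<in> resolvent_set A"
        using subsetD[OF domB v(1)] subsetD[OF MA, of z'] z' by simp_all
      have cnj: "cnj z' = - z'"
        using z' by (auto simp: imaginary_axis_def)
      show "cinner (resolvent A z' (adjoint_op B \<cdot> u)) w = 0"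
        unfolding v(2)
        by (rule adjoint_shifted_kernel_orthogonal[OF dA dB z'A cnj v(1) vB v(3) u])
    qed (use z0 in auto)
    show ?thesis
    proof (rule dense_orthogonal_zero[OF dense])
      fix x assume "x \<in> cspan {resolvent A z (adjoint_op B \<cdot> u) | z u. z \<in> M \<and> u \<in> dom (adjoint_op B)}"
      then show "cinner x w = 0"
      proof (rule cinner_eq_zero_cspan)
        fix y assume "y \<in> {resolvent A z (adjoint_op B \<cdot> u) | z u. z \<in> M \<and> u \<in> dom (adjoint_op B)}"
        then obtain z u where "y = resolvent A z (adjoint_op B \<cdot> u)" "z \<in> M" "u \<in> dom (adjoint_op B)"
          by blast
        then show "cinner y w = 0"
          by (simp only: vanish)
      qed
    qed
  qed
qed

section \<open>Graph representation, Riccati equation and core\<close>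

theorem theorem6p3:
  fixes A B C :: "'h::chilbert_space \<rightharpoonup> 'h"
    and T :: "'h \<times> 'h \<rightharpoonup> 'h \<times> 'h"
    and V :: "nat \<Rightarrow> ('h \<times> 'h) set"
  assumes separable: "separable_space (euclidean :: 'h topology)"
    and T_def: "T = hamiltonian_matrix A B C"
    and ham: "hamiltonian A B C"
    and nonneg: "nonneg_op B" "nonneg_op C"
    and dd: "diagonally_dominant A B C"
    and resolvent_T: "resolvent_set T \<inter> imaginary_axis \<noteq> {}"
    and basis: "finitely_spectral_basis T V"
    and a_or_b: "positive_op B \<or>
      (\<exists>M \<in> components (resolvent_set A).
        M \<inter> resolvent_set T \<inter> imaginary_axis \<noteq> {} \<and>
        closure (cspan {resolvent A z (adjoint_op B \<cdot> u) | z u. z \<in> M \<and> u \<in> dom (adjoint_op B)})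
          = UNIV)"
  shows "\<forall>U. csubspace U \<and> hypermaximal_J1_neutral U \<and> invariant_under T U \<and> compatible_with V U \<longrightarrow>
    (\<exists>X. U = Map.graph X \<and> selfadjoint_op X \<and>
      (\<forall>u \<in> riccati_domain A X.
        A \<cdot> u + B \<cdot> (X \<cdot> u) \<in> dom X \<and>
        X \<cdot> (A \<cdot> u + B \<cdot> (X \<cdot> u)) = C \<cdot> u - adjoint_op A \<cdot> (X \<cdot> u)) \<and>
      core_of (riccati_domain A X) X)"
proof (intro allI impI)
  fix U assume "csubspace U \<and> hypermaximal_J1_neutral U \<and> invariant_under T U \<and> compatible_with V U"
  then have U: "csubspace U" "hypermaximal_J1_neutral U" "invariant_under T U" "compatible_with V U"
    by auto
  have linT: "linear_op T" and V: "\<And>k. cfinite_dim (V k)" "\<And>k. V k \<subseteq> dom T" "\<And>k. invariant_under T (V k)"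
    using basis by (auto simp: finitely_spectral_basis_def closed_op_def)
  have linA: "linear_op A" and dA: "densely_defined A"
    using ham by (auto simp: hamiltonian_def)
  note domT = hamiltonian_matrix_dominant(1)[OF dd, folded T_def]
    and T_app = hamiltonian_matrix_dominant(2)[OF dd, folded T_def]
  have res: "resolvent T z x \<in> U" if "z \<in> resolvent_set T" "x \<in> U" for z x
    by (rule resolvent_invariant_subspace[OF linT that(1) V U(1,3,4) that(2)])
  obtain X where X: "linear_op X" "Map.graph X = U"
  proof (rule subspace_is_operator_graph[OF U(1)])
    show "w = 0" if "(0, w) \<in> U" for w
      by (rule neutral_vertical_part_trivial[OF ham T_def linT nonneg dd resolvent_T a_or_b U(2) res that])
  qed
  have graph: "(u, v) \<in> U \<longleftrightarrow> u \<in> dom X \<and> X \<cdot> u = v" for u v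
    unfolding X(2)[symmetric] Map.graph_def by auto
  have riccati: "A \<cdot> u + B \<cdot> (X \<cdot> u) \<in> dom X \<and>
      X \<cdot> (A \<cdot> u + B \<cdot> (X \<cdot> u)) = C \<cdot> u - adjoint_op A \<cdot> (X \<cdot> u)"
    if "u \<in> riccati_domain A X" for u
  proof -
    have u: "u \<in> dom A" "u \<in> dom X" "X \<cdot> u \<in> dom (adjoint_op A)"
      using that by (auto simp: riccati_domain_def)
    \<comment> \<open>The domain of \<open>T\<close> is a product, so
      \<open>(u, X \<cdot> u)\<close> lies in it. Invariance then puts its image into the graph of
      \<open>X\<close>: the first component is in \<open>dom X\<close> and is mapped to the
      second.\<close>
    then have "(u, X \<cdot> u) \<in> U \<inter> dom T"
      by (simp only: Int_iff graph domT mem_Sigma_iff simp_thms)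
    then have "T \<cdot> (u, X \<cdot> u) \<in> U"
      using U(3) unfolding invariant_under_def by blast
    then show ?thesis
      unfolding T_app[OF u(1,3)] graph .
  qed
  have "core_of (riccati_domain A X) X"
    unfolding core_of_def
  proof (intro conjI ballI)
    show "csubspace (riccati_domain A X)"
      by (rule csubspace_riccati_domain[OF linA dA X(1)])
    show "riccati_domain A X \<subseteq> dom X"
      by (auto simp: riccati_domain_def)
    fix x assume x: "x \<in> dom X"
    obtain W where W: "\<And>k. W k \<subseteq> V k" "U = closure (cspan (\<Union>k. W k))"
      using U(4) by (auto simp: compatible_with_def)
    have "(x, X \<cdot> x) \<in> closure (cspan (\<Union>k. W k))"
      using x by (simp only: W(2)[symmetric] graph simp_thms)
    \<comment> \<open>Convergence to \<open>(x, X \<cdot> x)\<close> in the product space, along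
      points of the graph, is convergence of the first components in the graph norm of
      \<open>X\<close>.\<close>
    then obtain s where s: "\<And>n. s n \<in> cspan (\<Union>k. W k)" "s \<longlonglongrightarrow> (x, X \<cdot> x)"
      using closure_sequential by blast
    \<comment> \<open>Finite sums of vectors from the spaces \<open>V k\<close> stay in
      \<open>dom T\<close>, a product of the domains of \<open>A\<close> and its adjoint; this
      places the first components in \<open>riccati_domain A X\<close>.\<close>
    have "cspan (\<Union>k. W k) \<subseteq> dom T"
      by (rule complex_vector.span_minimal[OF UN_least[OF order_trans[OF W(1) V(2)]] linear_opD(1)[OF linT]])
    then have dom: "s n \<in> dom T" for n
      using s(1) by (rule subsetD)
    have "s n \<in> U" for n
      unfolding W(2) using closure_subset s(1) by (rule subsetD)
    then have val: "fst (s n) \<in> dom X" "X \<cdot> fst (s n) = snd (s n)" for n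
      using graph[of "fst (s n)" "snd (s n)"] by simp_all
    have "fst (s n) \<in> riccati_domain A X" for n
      using dom[of n] val[of n] unfolding domT riccati_domain_def mem_Times_iff by simp
    with val(2) show "\<exists>s. (\<forall>n::nat. s n \<in> riccati_domain A X) \<and> s \<longlonglongrightarrow> x \<and> (\<lambda>n. X \<cdot> s n) \<longlonglongrightarrow> X \<cdot> x"
      using tendsto_fst[OF s(2)] tendsto_snd[OF s(2)] by (intro exI[of _ "\<lambda>n. fst (s n)"]) simp
  qed
  moreover have "selfadjoint_op X"
    using selfadjoint_if_graph_hypermaximal[OF X(1)] U(2) X(2) by simp
  ultimately show "\<exists>X. U = Map.graph X \<and> selfadjoint_op X \<and>
      (\<forall>u \<in> riccati_domain A X.
        A \<cdot> u + B \<cdot> (X \<cdot> u) \<in> dom X \<and>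
        X \<cdot> (A \<cdot> u + B \<cdot> (X \<cdot> u)) = C \<cdot> u - adjoint_op A \<cdot> (X \<cdot> u)) \<and>
      core_of (riccati_domain A X) X"
    by (intro exI[of _ X] conjI ballI riccati X(2)[symmetric])
qed

end
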